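(* Let $X$ and $Y$ be Banach spaces and $p,q\in[1,+\infty)$. Suppose that $f:X\to Y$ is a continuous map and that there exist $a>0$ and $b>0$ such that $\|f(x)\|\le a\|x\|^{p/q}+b$ for all $x\in X$. Let $\mathcal{N}_f$ be defined by $\mathcal{N}_f(u)=f\circ u$. Then: (i) $\mathcal{N}_f$ maps $S^p_{aa}(\mathbb{R},X)$ into $S^q_{aa}(\mathbb{R},Y)$ and $\mathcal{N}_f:S^p_{aa}(\mathbb{R},X)\to S^q_{aa}(\mathbb{R},Y)$ is continuous. (ii) $\mathcal{N}_f$ maps $S^p_{ap}(\mathbb{R},X)$ into $S^q_{ap}(\mathbb{R},Y)$ and $\mathcal{N}_f:S^p_{ap}(\mathbb{R},X)\to S^q_{ap}(\mathbb{R},Y)$ is continuous.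
   Context: For a Banach space $E$ and $1\le p<\infty$: $L^p(a,b;E)$ is the space of Bochner $p$-integrable functions on $(a,b)$ (functions equal a.e. are identified), and $L^p_{loc}(\mathbb{R},E)$ is the space of functions $u:\mathbb{R}\to E$ whose restriction to every bounded interval is in $L^p$ of that interval. The Bochner transform of $u\in L^p_{loc}(\mathbb{R},E)$ is the (continuous) map $u^b:\mathbb{R}\to L^p(0,1;E)$, $u^b(t)(\theta)=u(t+\theta)$, $\theta\in(0,1)$. A continuous function $u:\mathbb{R}\to E$ is almost periodic (in the sense of Bohr) if for each $\varepsilon>0$ the set $\{\tau\in\mathbb{R}:\sup_{t\in\mathbb{R}}\|u(t+\tau)-u(t)\|\le\varepsilon\}$ is relatively dense in $\mathbb{R}$ (meets every interval of some fixed length); the space of such functions is $AP(\mathbb{R},E)$. A continuous function $u:\mathbb{R}\to E$ is almost automorphic if every sequence of real numbers has a subsequence $(t_k)$ for which there is a function $v:\mathbb{R}\to E$ with $\lim_k u(t+t_k)=v(t)$ and $\lim_k v(t-t_k)=u(t)$ for every $t\in\mathbb{R}$; the space of such functions is $AA(\mathbb{R},E)$. $S^p_{aa}(\mathbb{R},E)=\{u\in L^p_{loc}(\mathbb{R},E): u^b\in AA(\mathbb{R},L^p(0,1;E))\}$ and $S^p_{ap}(\mathbb{R},E)=\{u\in L^p_{loc}(\mathbb{R},E): u^b\in AP(\mathbb{R},L^p(0,1;E))\}$ are Banach spaces with the norm $\|u\|_{S^p}=\sup_{t\in\mathbb{R}}\left(\int_0^1\|u(t+\theta)\|^p\,d\theta\right)^{1/p}$.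 *)

theory Defs
  imports "HOL-Analysis.Analysis"
begin

section \<open>Lebesgue--Bochner spaces\<close>

text \<open>
  The Bochner integral of the library is restricted to second countable spaces, whereas the Banach
  spaces considered here need not be separable.  Hence strong measurability is introduced in
  the usual way, through almost everywhere limits of simple functions.
\<close>

definition strongly_measurable :: "'a measure \<Rightarrow> ('a \<Rightarrow> 'e::real_normed_vector) \<Rightarrow> bool" where
  "strongly_measurable M f \<longleftrightarrow>
     (\<exists>s. (\<forall>n. simple_function M (s n)) \<and> (AE x in M. (\<lambda>n. s n x) \<longlonglongrightarrow> f x))"

definition Lp_fun :: "'a measure \<Rightarrow> real \<Rightarrow> ('a \<Rightarrow> 'e::real_normed_vector) set" where
  "Lp_fun M p = {f. strongly_measurable M f \<and> integrable M (\<lambda>x. norm (f x) powr p)}"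

definition Lp_norm :: "'a measure \<Rightarrow> real \<Rightarrow> ('a \<Rightarrow> 'e::real_normed_vector) \<Rightarrow> real" where
  "Lp_norm M p f = (\<integral>x. norm (f x) powr p \<partial>M) powr (1 / p)"

text \<open>
  Functions that agree almost everywhere are identified by passing to equivalence classes.  The
  values of a function outside \<open>space M\<close> are irrelevant for its class.
\<close>

definition ae_class :: "'a measure \<Rightarrow> ('a \<Rightarrow> 'e) \<Rightarrow> ('a \<Rightarrow> 'e) set" where
  "ae_class M f = {g. AE x in M. f x = g x}"

definition ae_rep :: "('a \<Rightarrow> 'e) set \<Rightarrow> 'a \<Rightarrow> 'e" where
  "ae_rep F = (SOME f. f \<in> F)"

definition Lp :: "'a measure \<Rightarrow> real \<Rightarrow> ('a \<Rightarrow> 'e::real_normed_vector) set set" where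
  "Lp M p = ae_class M ` Lp_fun M p"

definition Lp_dist ::
    "'a measure \<Rightarrow> real \<Rightarrow> ('a \<Rightarrow> 'e::real_normed_vector) set \<Rightarrow> ('a \<Rightarrow> 'e) set \<Rightarrow> real" where
  "Lp_dist M p F G = Lp_norm M p (\<lambda>x. ae_rep F x - ae_rep G x)"

text \<open>
  This is well behaved for \<open>p \<ge> 1\<close> and complete measures \<open>M\<close>; see \<open>Metric_space_Lp\<close> below.
\<close>

definition Lp_metric :: "'a measure \<Rightarrow> real \<Rightarrow> ('a \<Rightarrow> 'e::real_normed_vector) set metric" where
  "Lp_metric M p = metric (Lp M p, Lp_dist M p)"

abbreviation unit_interval :: "real measure" where
  "unit_interval \<equiv> lebesgue_on {0<..<1}"


section \<open>Almost periodic and almost automorphic functions\<close>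

definition relatively_dense :: "real set \<Rightarrow> bool" where
  "relatively_dense T \<longleftrightarrow> (\<exists>l>0. \<forall>a. T \<inter> {a..a + l} \<noteq> {})"

definition almost_periodic :: "'x metric \<Rightarrow> (real \<Rightarrow> 'x) \<Rightarrow> bool" where
  "almost_periodic m u \<longleftrightarrow>
     continuous_map euclideanreal (mtopology_of m) u \<and>
     (\<forall>\<epsilon>>0. relatively_dense {\<tau>. (SUP t. ereal (mdist m (u (t + \<tau>)) (u t))) \<le> ereal \<epsilon>})"

definition almost_automorphic :: "'x metric \<Rightarrow> (real \<Rightarrow> 'x) \<Rightarrow> bool" where
  "almost_automorphic m u \<longleftrightarrow>
     continuous_map euclideanreal (mtopology_of m) u \<and>
     (\<forall>s :: nat \<Rightarrow> real. \<exists>r :: nat \<Rightarrow> nat. strict_mono r \<and>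
        (\<exists>v. \<forall>t. limitin (mtopology_of m) (\<lambda>k. u (t + s (r k))) (v t) sequentially \<and>
                 limitin (mtopology_of m) (\<lambda>k. v (t - s (r k))) (u t) sequentially))"


section \<open>Stepanov spaces\<close>

definition Lp_loc_fun :: "real \<Rightarrow> (real \<Rightarrow> 'e::real_normed_vector) set" where
  "Lp_loc_fun p = {u. \<forall>a b. u \<in> Lp_fun (lebesgue_on {a<..<b}) p}"

definition Lp_loc :: "real \<Rightarrow> (real \<Rightarrow> 'e::real_normed_vector) set set" where
  "Lp_loc p = ae_class lebesgue ` Lp_loc_fun p"

definition bochner_transform :: "(real \<Rightarrow> 'e) set \<Rightarrow> real \<Rightarrow> (real \<Rightarrow> 'e) set" where
  "bochner_transform U t = ae_class unit_interval (\<lambda>\<theta>. ae_rep U (t + \<theta>))"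

definition Sp_aa :: "real \<Rightarrow> (real \<Rightarrow> 'e::real_normed_vector) set set" where
  "Sp_aa p = {U \<in> Lp_loc p. almost_automorphic (Lp_metric unit_interval p) (bochner_transform U)}"

definition Sp_ap :: "real \<Rightarrow> (real \<Rightarrow> 'e::real_normed_vector) set set" where
  "Sp_ap p = {U \<in> Lp_loc p. almost_periodic (Lp_metric unit_interval p) (bochner_transform U)}"

text \<open>
  The supremum is taken in \<^typ>\<open>ennreal\<close>, as a supremum of an unbounded set of reals is unspecified.
  On the Stepanov spaces it is finite; see \<open>Sp_aa_bounded\<close> and \<open>Sp_ap_bounded\<close> below.
\<close>

definition Sp_enorm :: "real \<Rightarrow> (real \<Rightarrow> 'e::real_normed_vector) \<Rightarrow> ennreal" where
  "Sp_enorm p u = (SUP t. ennreal (Lp_norm unit_interval p (\<lambda>\<theta>. u (t + \<theta>))))"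

definition Sp_norm :: "real \<Rightarrow> (real \<Rightarrow> 'e::real_normed_vector) \<Rightarrow> real" where
  "Sp_norm p u = enn2real (Sp_enorm p u)"

definition Sp_dist ::
    "real \<Rightarrow> (real \<Rightarrow> 'e::real_normed_vector) set \<Rightarrow> (real \<Rightarrow> 'e) set \<Rightarrow> real" where
  "Sp_dist p U V = Sp_norm p (\<lambda>x. ae_rep U x - ae_rep V x)"

definition Sp_aa_metric :: "real \<Rightarrow> (real \<Rightarrow> 'e::real_normed_vector) set metric" where
  "Sp_aa_metric p = metric (Sp_aa p, Sp_dist p)"

definition Sp_ap_metric :: "real \<Rightarrow> (real \<Rightarrow> 'e::real_normed_vector) set metric" where
  "Sp_ap_metric p = metric (Sp_ap p, Sp_dist p)"

definition nemytskii :: "('d \<Rightarrow> 'e) \<Rightarrow> (real \<Rightarrow> 'd) set \<Rightarrow> (real \<Rightarrow> 'e) set" where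
  "nemytskii f U = ae_class lebesgue (f \<circ> ae_rep U)"


section \<open>Well-definedness\<close>

subsection \<open>Classes and representatives\<close>

lemma ae_class_refl: "f \<in> ae_class M f"
  by (simp add: ae_class_def)

lemma ae_class_eq_iff: "ae_class M f = ae_class M g \<longleftrightarrow> (AE x in M. f x = g x)"
proof
  assume "ae_class M f = ae_class M g"
  then have "g \<in> ae_class M f" by (simp add: ae_class_refl)
  then show "AE x in M. f x = g x" by (simp add: ae_class_def)
next
  assume *: "AE x in M. f x = g x"
  have "(AE x in M. f x = h x) \<longleftrightarrow> (AE x in M. g x = h x)" for h
  proof
    show "AE x in M. g x = h x" if "AE x in M. f x = h x"
      using * that by eventually_elim simp
    show "AE x in M. f x = h x" if "AE x in M. g x = h x"
      using * that by eventually_elim simp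
  qed
  then show "ae_class M f = ae_class M g" by (simp add: ae_class_def)
qed

lemma AE_ae_rep: "AE x in M. f x = ae_rep (ae_class M f) x"
proof -
  have "ae_rep (ae_class M f) \<in> ae_class M f"
    unfolding ae_rep_def by (rule someI[of _ f], rule ae_class_refl)
  then show ?thesis by (simp add: ae_class_def)
qed

lemma nemytskii_ae_class: "nemytskii f (ae_class lebesgue u) = ae_class lebesgue (f \<circ> u)"
  unfolding nemytskii_def ae_class_eq_iff
  using AE_ae_rep[of u lebesgue] by (auto elim: eventually_mono)

lemma complete_measure_lebesgue_on:
  assumes "S \<in> sets lebesgue"
  shows "complete_measure (lebesgue_on S)"
proof
  fix A B assume "A \<subseteq> B" "B \<in> null_sets (lebesgue_on S)"
  then have "A \<subseteq> S" "A \<in> null_sets lebesgue"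
    using assms by (auto simp: null_sets_restrict_space null_sets_completion_subset)
  then show "A \<in> sets (lebesgue_on S)"
    using assms by (auto simp: sets_restrict_space_iff)
qed

lemma (in complete_measure) borel_measurable_AE_eq:
  fixes f g :: "'a \<Rightarrow> 'e::topological_space"
  assumes "f \<in> borel_measurable M" "AE x in M. f x = g x"
  shows "g \<in> borel_measurable M"
proof (rule measurableI)
  fix A :: "'e set" assume A: "A \<in> sets borel"
  show "g -` A \<inter> space M \<in> sets M"
  proof (rule in_sets_AE)
    show "AE x in M. x \<in> f -` A \<inter> space M \<longleftrightarrow> x \<in> g -` A \<inter> space M"
      using assms(2) by (auto elim: eventually_mono)
    show "f -` A \<inter> space M \<in> sets M" using assms(1) A by (rule measurable_sets)
  qed auto
qed auto

lemma (in complete_measure) strongly_measurable_norm: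
  assumes "strongly_measurable M f"
  shows "(\<lambda>x. norm (f x)) \<in> borel_measurable M"
proof -
  obtain s where s: "\<And>n. simple_function M (s n)" "AE x in M. (\<lambda>n. s n x) \<longlonglongrightarrow> f x"
    using assms by (auto simp: strongly_measurable_def)
  have "(\<lambda>x. norm (s n x)) \<in> borel_measurable M" for n
    using simple_function_compose[OF s(1), of norm n]
    by (auto simp: o_def intro: borel_measurable_simple_function)
  then have "(\<lambda>x. lim (\<lambda>n. norm (s n x))) \<in> borel_measurable M"
    by (rule borel_measurable_lim_metric)
  moreover have "AE x in M. lim (\<lambda>n. norm (s n x)) = norm (f x)"
    using s(2) by eventually_elim (intro limI tendsto_norm)
  ultimately show ?thesis by (rule borel_measurable_AE_eq)
qed

lemma strongly_measurable_AE_eq: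
  assumes "strongly_measurable M f" "AE x in M. f x = g x"
  shows "strongly_measurable M g"
proof -
  obtain s where s: "\<And>n. simple_function M (s n)" "AE x in M. (\<lambda>n. s n x) \<longlonglongrightarrow> f x"
    using assms by (auto simp: strongly_measurable_def)
  have "AE x in M. (\<lambda>n. s n x) \<longlonglongrightarrow> g x"
    using s(2) assms(2) by eventually_elim simp
  with s(1) show ?thesis by (auto simp: strongly_measurable_def)
qed

lemma strongly_measurable_diff:
  assumes "strongly_measurable M f" "strongly_measurable M g"
  shows "strongly_measurable M (\<lambda>x. f x - g x)"
proof -
  obtain s where s: "\<And>n. simple_function M (s n)" "AE x in M. (\<lambda>n. s n x) \<longlonglongrightarrow> f x"
    using assms by (auto simp: strongly_measurable_def)
  obtain r where r: "\<And>n. simple_function M (r n)" "AE x in M. (\<lambda>n. r n x) \<longlonglongrightarrow> g x"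
    using assms by (auto simp: strongly_measurable_def)
  have "simple_function M (\<lambda>x. s n x - r n x)" for n
    using s(1) r(1) by (rule simple_function_compose2)
  moreover have "AE x in M. (\<lambda>n. s n x - r n x) \<longlonglongrightarrow> f x - g x"
    using s(2) r(2) by eventually_elim (rule tendsto_diff)
  ultimately show ?thesis unfolding strongly_measurable_def
    by (intro exI[of _ "\<lambda>n x. s n x - r n x"]) simp
qed


subsection \<open>Minkowski's inequality\<close>

lemma powr_add_le:
  fixes x y A B p :: real
  assumes "x \<ge> 0" "y \<ge> 0" "A > 0" "B > 0" "p \<ge> 1"
  shows "(x + y) powr p \<le> (A + B) powr p * (A / (A + B) * (x powr p / A powr p) + B / (A + B) * (y powr p / B powr p))"
proof -
  have cv: "convex_on {0..} (\<lambda>x::real. x powr p)"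
  proof (rule convex_onI)
    fix t x y :: real
    assume t: "0 < t" "t < 1" and xy: "x \<in> {0..}" "y \<in> {0..}"
    have small: "c powr p \<le> c" if "0 < c" "c < 1" for c :: real
      using powr_mono'[of 1 p c] that assms by simp
    show "((1 - t) *\<^sub>R x + t *\<^sub>R y) powr p \<le> (1 - t) * x powr p + t * y powr p"
    proof (cases "x = 0 \<or> y = 0")
      case True
      then show ?thesis
        using t xy small[of t] small[of "1 - t"] assms
        by (auto simp: powr_mult mult_right_mono)
    next
      case False
      then have "x > 0" "y > 0" using xy by auto
      then show ?thesis
        using convex_onD[OF powr_convex[OF assms(5)], of t x y] t by auto
    qed
  qed auto
  have 1: "1 - B / (A + B) = A / (A + B)" using assms by (simp add: field_simps)
  have e: "(x + y) / (A + B) = A / (A + B) * (x / A) + B / (A + B) * (y / B)"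
    using assms by (simp add: add_divide_distrib)
  have "((x + y) / (A + B)) powr p \<le> A / (A + B) * (x / A) powr p + B / (A + B) * (y / B) powr p"
    using convex_onD[OF cv, of "B / (A + B)" "x / A" "y / B"] assms by (simp add: 1 e)
  then have "(A + B) powr p * ((x + y) / (A + B)) powr p \<le>
     (A + B) powr p * (A / (A + B) * (x / A) powr p + B / (A + B) * (y / B) powr p)"
    by (rule mult_left_mono) simp
  then show ?thesis using assms by (simp add: powr_divide)
qed

lemma Lp_norm_nonneg [simp]: "0 \<le> Lp_norm M p f"
  by (simp add: Lp_norm_def)

lemma Lp_norm_commute: "Lp_norm M p (\<lambda>x. f x - g x) = Lp_norm M p (\<lambda>x. g x - f x)"
  by (simp add: Lp_norm_def norm_minus_commute)

lemma (in complete_measure) Lp_fun_AE_eq: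
  assumes "f \<in> Lp_fun M p" "AE x in M. f x = g x"
  shows "g \<in> Lp_fun M p" "Lp_norm M p g = Lp_norm M p f"
proof -
  have f: "strongly_measurable M f" "integrable M (\<lambda>x. norm (f x) powr p)"
    using assms by (auto simp: Lp_fun_def)
  have g: "strongly_measurable M g" using strongly_measurable_AE_eq[OF f(1) assms(2)] .
  have [measurable]: "(\<lambda>x. norm (g x)) \<in> borel_measurable M" "(\<lambda>x. norm (f x)) \<in> borel_measurable M"
    using strongly_measurable_norm g f by auto
  have ae: "AE x in M. norm (f x) powr p = norm (g x) powr p"
    using assms(2) by eventually_elim simp
  have "integrable M (\<lambda>x. norm (g x) powr p)"
    by (rule integrable_cong_AE_imp[OF f(2)]) (use ae in \<open>auto elim: eventually_mono\<close>)
  with g show "g \<in> Lp_fun M p" by (simp add: Lp_fun_def)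
  have "(\<integral>x. norm (f x) powr p \<partial>M) = (\<integral>x. norm (g x) powr p \<partial>M)"
    by (rule integral_cong_AE) (use ae in auto)
  then show "Lp_norm M p g = Lp_norm M p f" by (simp add: Lp_norm_def)
qed

lemma (in complete_measure) Lp_minkowski:
  assumes f: "f \<in> Lp_fun M p" and g: "g \<in> Lp_fun M p" and p: "p \<ge> 1"
  shows "(\<lambda>x. f x - g x) \<in> Lp_fun M p"
    and "Lp_norm M p (\<lambda>x. f x - g x) \<le> Lp_norm M p f + Lp_norm M p g"
proof -
  have sm: "strongly_measurable M (\<lambda>x. f x - g x)"
    using f g by (auto simp: Lp_fun_def intro: strongly_measurable_diff)
  have [measurable]: "(\<lambda>x. norm (f x - g x)) \<in> borel_measurable M"
    using strongly_measurable_norm[OF sm] .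
  have fi: "integrable M (\<lambda>x. norm (f x) powr p)" and gi: "integrable M (\<lambda>x. norm (g x) powr p)"
    using f g by (auto simp: Lp_fun_def)
  let ?h = "\<lambda>A B x. (A + B) powr p * (A / (A + B) * (norm (f x) powr p / A powr p)
                       + B / (A + B) * (norm (g x) powr p / B powr p))"
  have hi: "integrable M (?h A B)" for A B
    by (intro integrable_mult_right Bochner_Integration.integrable_add integrable_divide fi gi)
  have le: "norm (f x - g x) powr p \<le> ?h A B x" if "A > 0" "B > 0" for A B x
  proof -
    have "norm (f x - g x) powr p \<le> (norm (f x) + norm (g x)) powr p"
      using p by (intro powr_mono2) (auto simp: norm_triangle_ineq4)
    also have "\<dots> \<le> ?h A B x" using that p by (intro powr_add_le) auto
    finally show ?thesis .
  qed
  have int: "integrable M (\<lambda>x. norm (f x - g x) powr p)"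
    by (rule Bochner_Integration.integrable_bound[OF hi[of 1 1]])
       (use order_trans[OF le[of 1 1] abs_ge_self] in auto)
  with sm show "(\<lambda>x. f x - g x) \<in> Lp_fun M p" by (simp add: Lp_fun_def)
  have bound: "(\<integral>x. norm (k x) powr p \<partial>M) \<le> A powr p"
    if "Lp_norm M p k < A" for A and k :: "'a \<Rightarrow> 'b"
  proof -
    have "((\<integral>x. norm (k x) powr p \<partial>M) powr (1 / p)) powr p \<le> A powr p"
      using that p by (intro powr_mono2) (auto simp: Lp_norm_def)
    then show ?thesis using p by (simp add: powr_powr)
  qed
  show "Lp_norm M p (\<lambda>x. f x - g x) \<le> Lp_norm M p f + Lp_norm M p g"
  proof (rule field_le_epsilon)
    fix e :: real assume "e > 0"
    define A where "A = Lp_norm M p f + e / 2"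
    define B where "B = Lp_norm M p g + e / 2"
    have AB: "Lp_norm M p f < A" "Lp_norm M p g < B" "A > 0" "B > 0"
      using \<open>e > 0\<close> by (auto simp: A_def B_def add_nonneg_pos)
    have "(\<integral>x. norm (f x - g x) powr p \<partial>M) \<le> (\<integral>x. ?h A B x \<partial>M)"
      by (intro integral_mono int hi le AB)
    also have "\<dots> = (A + B) powr p * (A / (A + B) * ((\<integral>x. norm (f x) powr p \<partial>M) / A powr p)
                       + B / (A + B) * ((\<integral>x. norm (g x) powr p \<partial>M) / B powr p))"
      using fi gi by simp
    also have "\<dots> \<le> (A + B) powr p * (A / (A + B) * 1 + B / (A + B) * 1)"
      using bound[OF AB(1)] bound[OF AB(2)] AB
      by (intro mult_left_mono add_mono) auto
    also have "\<dots> = (A + B) powr p" using AB by (simp flip: add_divide_distrib)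
    finally have "(\<integral>x. norm (f x - g x) powr p \<partial>M) powr (1 / p) \<le> ((A + B) powr p) powr (1 / p)"
      using p by (intro powr_mono2) auto
    also have "\<dots> = A + B" using p AB by (simp add: powr_powr)
    finally show "Lp_norm M p (\<lambda>x. f x - g x) \<le> Lp_norm M p f + Lp_norm M p g + e"
      by (simp add: Lp_norm_def A_def B_def)
  qed
qed

lemma (in complete_measure) Lp_norm_triangle:
  assumes "f \<in> Lp_fun M p" "g \<in> Lp_fun M p" "h \<in> Lp_fun M p" "p \<ge> 1"
  shows "Lp_norm M p (\<lambda>x. f x - h x) \<le> Lp_norm M p (\<lambda>x. f x - g x) + Lp_norm M p (\<lambda>x. g x - h x)"
  using Lp_minkowski(2)[OF Lp_minkowski(1)[OF assms(1,2,4)] Lp_minkowski(1)[OF assms(3,2,4)] assms(4)]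
  by (simp add: Lp_norm_commute[of M p h g])

lemma (in complete_measure) Lp_norm_eq_0_iff:
  assumes "f \<in> Lp_fun M p" "p \<ge> 1"
  shows "Lp_norm M p f = 0 \<longleftrightarrow> (AE x in M. f x = 0)"
  using assms integral_nonneg_eq_0_iff_AE[of M "\<lambda>x. norm (f x) powr p"]
  by (simp add: Lp_norm_def Lp_fun_def)


subsection \<open>The metric of \<open>L\<^sup>p\<close>\<close>

lemma (in complete_measure) ae_rep_Lp_fun:
  assumes "f \<in> Lp_fun M p" shows "ae_rep (ae_class M f) \<in> Lp_fun M p"
  using Lp_fun_AE_eq(1)[OF assms AE_ae_rep] .

lemma (in complete_measure) Lp_dist_ae_class:
  assumes "f \<in> Lp_fun M p" "g \<in> Lp_fun M p" "p \<ge> 1"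
  shows "Lp_dist M p (ae_class M f) (ae_class M g) = Lp_norm M p (\<lambda>x. f x - g x)"
  unfolding Lp_dist_def
proof (rule Lp_fun_AE_eq(2))
  show "(\<lambda>x. f x - g x) \<in> Lp_fun M p" using Lp_minkowski(1) assms by blast
  show "AE x in M. f x - g x = ae_rep (ae_class M f) x - ae_rep (ae_class M g) x"
    using AE_ae_rep[of f M] AE_ae_rep[of g M] by eventually_elim simp
qed

lemma (in complete_measure) Metric_space_Lp:
  assumes "p \<ge> 1"
  shows "Metric_space (Lp M p :: ('a \<Rightarrow> 'e::real_normed_vector) set set) (Lp_dist M p)"
proof
  fix F G H :: "('a \<Rightarrow> 'e) set"
  show "0 \<le> Lp_dist M p F G" by (simp add: Lp_dist_def)
  show "Lp_dist M p F G = Lp_dist M p G F" unfolding Lp_dist_def by (rule Lp_norm_commute)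
  assume "F \<in> Lp M p" "G \<in> Lp M p"
  then obtain f g where fg: "f \<in> Lp_fun M p" "g \<in> Lp_fun M p" "F = ae_class M f" "G = ae_class M g"
    by (auto simp: Lp_def)
  show "Lp_dist M p F G = 0 \<longleftrightarrow> F = G"
    using Lp_norm_eq_0_iff[OF Lp_minkowski(1)[OF fg(1,2) assms] assms] fg assms
    by (simp add: Lp_dist_ae_class ae_class_eq_iff)
  assume "H \<in> Lp M p"
  then obtain h where h: "h \<in> Lp_fun M p" "H = ae_class M h" by (auto simp: Lp_def)
  show "Lp_dist M p F H \<le> Lp_dist M p F G + Lp_dist M p G H"
    using Lp_norm_triangle[OF fg(1,2) h(1) assms] fg h assms by (simp add: Lp_dist_ae_class)
qed

lemma (in complete_measure) Lp_metric_simps: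
  assumes "p \<ge> 1"
  shows "mspace (Lp_metric M p) = Lp M p" "mdist (Lp_metric M p) = Lp_dist M p"
  unfolding Lp_metric_def
  using Metric_space.mspace_metric[OF Metric_space_Lp[OF assms]]
        Metric_space.mdist_metric[OF Metric_space_Lp[OF assms]] by auto

interpretation unit_interval: complete_measure unit_interval
  by (rule complete_measure_lebesgue_on) simp


subsection \<open>Translations\<close>

lemma AE_unit_interval_shift:
  "(AE \<theta> in unit_interval. P (t + \<theta>)) \<longleftrightarrow> (AE x in lebesgue_on {t<..<t+1}. P x)"
proof -
  have *: "(AE x in lebesgue_on S. Q x) \<longleftrightarrow> negligible {x\<in>S. \<not> Q x}" if "S \<in> sets lebesgue" for S and Q :: "real \<Rightarrow> bool"
  proof -
    interpret complete_measure "lebesgue_on S" using that by (rule complete_measure_lebesgue_on)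
    show ?thesis using that
      by (simp add: AE_iff_null_sets null_sets_restrict_space negligible_iff_null_sets)
  qed
  have eq: "{x\<in>{t<..<t+1}. \<not> P x} = (+) t ` {\<theta>\<in>{0<..<1}. \<not> P (t + \<theta>)}"
  proof (intro equalityI subsetI)
    fix x assume "x \<in> {x\<in>{t<..<t+1}. \<not> P x}"
    then show "x \<in> (+) t ` {\<theta>\<in>{0<..<1}. \<not> P (t + \<theta>)}"
      by (intro image_eqI[of _ _ "x - t"]) auto
  qed auto
  have "{0<..<1::real} \<in> sets lebesgue" "{t<..<t+1} \<in> sets lebesgue" by simp_all
  then show ?thesis
    unfolding *[OF \<open>{0<..<1} \<in> _\<close>] *[OF \<open>{t<..<t+1} \<in> _\<close>] eq
    by (blast intro: negligible_translation negligible_translation_rev)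
qed

lemma AE_lebesgue_on_of_AE:
  assumes "AE x in lebesgue. P x" "S \<in> sets lebesgue"
  shows "AE x in lebesgue_on S. P x"
  using assms by (subst AE_restrict_space_iff) (auto elim: eventually_mono)

lemma AE_lebesgue_iff_shift:
  "(AE x in lebesgue. P x) \<longleftrightarrow> (\<forall>t. AE \<theta> in unit_interval. P (t + \<theta>))"
proof
  assume "AE x in lebesgue. P x"
  then show "\<forall>t. AE \<theta> in unit_interval. P (t + \<theta>)"
    by (simp add: AE_unit_interval_shift AE_lebesgue_on_of_AE)
next
  assume "\<forall>t. AE \<theta> in unit_interval. P (t + \<theta>)"
  then have "AE x in lebesgue. x \<in> {t<..<t+1} \<longrightarrow> P x" for t
    by (simp add: AE_unit_interval_shift AE_restrict_space_iff)
  then have "AE x in lebesgue. \<forall>q\<in>\<rat>. x \<in> {q<..<q+1} \<longrightarrow> P x"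
    by (intro AE_ball_countable') (auto simp: countable_rat)
  then show "AE x in lebesgue. P x"
  proof eventually_elim
    case (elim x)
    obtain q where "q \<in> \<rat>" "x - 1 < q" "q < x" using Rats_dense_in_real[of "x - 1" x] by auto
    with elim show ?case by auto
  qed
qed

lemma bochner_transform_ae_class:
  "bochner_transform (ae_class lebesgue u) t = ae_class unit_interval (\<lambda>\<theta>. u (t + \<theta>))"
proof -
  have "AE x in lebesgue. ae_rep (ae_class lebesgue u) x = u x"
    using AE_ae_rep[of u lebesgue] by (auto elim: eventually_mono)
  then show ?thesis
    unfolding bochner_transform_def ae_class_eq_iff AE_lebesgue_iff_shift by blast
qed

lemma Lp_loc_fun_shift:
  assumes "u \<in> Lp_loc_fun p"
  shows "(\<lambda>\<theta>. u (t + \<theta>)) \<in> Lp_fun unit_interval p"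
proof -
  have u: "strongly_measurable (lebesgue_on {t<..<t+1}) u"
      "integrable (lebesgue_on {t<..<t+1}) (\<lambda>x. norm (u x) powr p)"
    using assms by (auto simp: Lp_loc_fun_def Lp_fun_def)
  obtain s where s: "\<And>n. simple_function (lebesgue_on {t<..<t+1}) (s n)"
      "AE x in lebesgue_on {t<..<t+1}. (\<lambda>n. s n x) \<longlonglongrightarrow> u x"
    using u(1) by (auto simp: strongly_measurable_def)
  have "(\<lambda>x. t + 1 * x) \<in> lebesgue \<rightarrow>\<^sub>M lebesgue"
    using lebesgue_affine_measurable[where c="\<lambda>x. 1", of t] by simp
  then have m: "(\<lambda>x. t + x) \<in> unit_interval \<rightarrow>\<^sub>M lebesgue_on {t<..<t+1}"
    by (intro measurable_restrict_space3) auto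
  have "simple_function unit_interval (\<lambda>\<theta>. s n (t + \<theta>))" for n
    using simple_function_comp[OF m s(1)[of n]] by (simp add: o_def)
  moreover have "AE \<theta> in unit_interval. (\<lambda>n. s n (t + \<theta>)) \<longlonglongrightarrow> u (t + \<theta>)"
    using s(2) AE_unit_interval_shift[where P="\<lambda>x. (\<lambda>n. s n x) \<longlonglongrightarrow> u x"] by simp
  ultimately have "strongly_measurable unit_interval (\<lambda>\<theta>. u (t + \<theta>))"
    unfolding strongly_measurable_def by (intro exI[of _ "\<lambda>n \<theta>. s n (t + \<theta>)"]) simp
  moreover have "integrable unit_interval (\<lambda>\<theta>. norm (u (t + \<theta>)) powr p)"
  proof -
    have "integrable lebesgue (\<lambda>x. indicator {t<..<t+1} x *\<^sub>R (norm (u x) powr p))"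
      using u(2) by (subst (asm) integrable_restrict_space) auto
    then have "integrable lebesgue (\<lambda>x. indicator {t<..<t+1} (t + 1 * x) *\<^sub>R (norm (u (t + 1 * x)) powr p))"
      by (rule lebesgue_integrable_real_affine) simp
    moreover have "indicator {t<..<t+1} (t + 1 * x) = (indicator {0<..<1} x :: real)" for x
      by (auto simp: indicator_def)
    ultimately show ?thesis
      by (subst integrable_restrict_space) auto
  qed
  ultimately show ?thesis by (simp add: Lp_fun_def)
qed

lemma ae_rep_Lp_loc_fun:
  assumes "u \<in> Lp_loc_fun p" shows "ae_rep (ae_class lebesgue u) \<in> Lp_loc_fun p"
  unfolding Lp_loc_fun_def
proof (intro CollectI allI)
  fix a b :: real
  interpret complete_measure "lebesgue_on {a<..<b}" by (rule complete_measure_lebesgue_on) simp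
  show "ae_rep (ae_class lebesgue u) \<in> Lp_fun (lebesgue_on {a<..<b}) p"
  proof (rule Lp_fun_AE_eq(1))
    show "u \<in> Lp_fun (lebesgue_on {a<..<b}) p" using assms by (simp add: Lp_loc_fun_def)
    show "AE x in lebesgue_on {a<..<b}. u x = ae_rep (ae_class lebesgue u) x"
      by (intro AE_lebesgue_on_of_AE AE_ae_rep) simp
  qed
qed


subsection \<open>The metric of the Stepanov spaces\<close>

lemma Sp_enorm_cong:
  assumes "AE x in lebesgue. u x = v x" "\<And>t. (\<lambda>\<theta>. u (t + \<theta>)) \<in> Lp_fun unit_interval p"
  shows "Sp_enorm p v = Sp_enorm p u"
proof -
  have "Lp_norm unit_interval p (\<lambda>\<theta>. v (t + \<theta>)) = Lp_norm unit_interval p (\<lambda>\<theta>. u (t + \<theta>))" for t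
    using assms by (intro unit_interval.Lp_fun_AE_eq(2)) (auto simp: AE_lebesgue_iff_shift)
  then show ?thesis by (simp add: Sp_enorm_def)
qed

lemma Sp_dist_ae_class:
  assumes "u \<in> Lp_loc_fun p" "v \<in> Lp_loc_fun p" "p \<ge> 1"
  shows "Sp_dist p (ae_class lebesgue u) (ae_class lebesgue v) = Sp_norm p (\<lambda>x. u x - v x)"
proof -
  have "AE x in lebesgue. u x - v x = ae_rep (ae_class lebesgue u) x - ae_rep (ae_class lebesgue v) x"
    using AE_ae_rep[of u lebesgue] AE_ae_rep[of v lebesgue] by eventually_elim simp
  then show ?thesis unfolding Sp_dist_def Sp_norm_def
    using assms
    by (subst Sp_enorm_cong) (simp_all add: unit_interval.Lp_minkowski(1) Lp_loc_fun_shift)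
qed

lemma Sp_enorm_triangle:
  assumes "u \<in> Lp_loc_fun p" "v \<in> Lp_loc_fun p" "w \<in> Lp_loc_fun p" "p \<ge> 1"
  shows "Sp_enorm p (\<lambda>x. u x - w x) \<le> Sp_enorm p (\<lambda>x. u x - v x) + Sp_enorm p (\<lambda>x. v x - w x)"
  unfolding Sp_enorm_def
proof (rule SUP_least)
  fix t
  let ?N = "\<lambda>u. Lp_norm unit_interval p (\<lambda>\<theta>. u (t + \<theta>))"
  have "?N (\<lambda>x. u x - w x) \<le> ?N (\<lambda>x. u x - v x) + ?N (\<lambda>x. v x - w x)"
    using assms by (intro unit_interval.Lp_norm_triangle Lp_loc_fun_shift)
  then have "ennreal (?N (\<lambda>x. u x - w x)) \<le> ennreal (?N (\<lambda>x. u x - v x)) + ennreal (?N (\<lambda>x. v x - w x))"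
    by (simp flip: ennreal_plus)
  also have "\<dots> \<le> (SUP t. ennreal (Lp_norm unit_interval p (\<lambda>\<theta>. u (t + \<theta>) - v (t + \<theta>)))) +
                  (SUP t. ennreal (Lp_norm unit_interval p (\<lambda>\<theta>. v (t + \<theta>) - w (t + \<theta>))))"
    by (intro add_mono SUP_upper) auto
  finally show "ennreal (?N (\<lambda>x. u x - w x)) \<le> \<dots>" .
qed

lemma Sp_enorm_diff_finite:
  assumes "u \<in> Lp_loc_fun p" "v \<in> Lp_loc_fun p" "p \<ge> 1" "Sp_enorm p u < \<infinity>" "Sp_enorm p v < \<infinity>"
  shows "Sp_enorm p (\<lambda>x. u x - v x) < \<infinity>"
proof -
  have "Sp_enorm p (\<lambda>x. u x - v x) \<le> Sp_enorm p u + Sp_enorm p v"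
    unfolding Sp_enorm_def
  proof (rule SUP_least)
    fix t
    let ?N = "\<lambda>u. Lp_norm unit_interval p (\<lambda>\<theta>. u (t + \<theta>))"
    have "?N (\<lambda>x. u x - v x) \<le> ?N u + ?N v"
      using assms by (intro unit_interval.Lp_minkowski(2) Lp_loc_fun_shift)
    then have "ennreal (?N (\<lambda>x. u x - v x)) \<le> ennreal (?N u) + ennreal (?N v)"
      by (simp flip: ennreal_plus)
    also have "\<dots> \<le> (SUP t. ennreal (Lp_norm unit_interval p (\<lambda>\<theta>. u (t + \<theta>)))) +
                    (SUP t. ennreal (Lp_norm unit_interval p (\<lambda>\<theta>. v (t + \<theta>))))"
      by (intro add_mono SUP_upper) auto
    finally show "ennreal (?N (\<lambda>x. u x - v x)) \<le> \<dots>" .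
  qed
  also have "\<dots> < \<infinity>" using assms by simp
  finally show ?thesis .
qed

lemma Metric_space_Sp:
  fixes S :: "(real \<Rightarrow> 'e::real_normed_vector) set set"
  assumes p: "p \<ge> 1" and S: "\<And>U. U \<in> S \<Longrightarrow> U \<in> Lp_loc p \<and> Sp_enorm p (ae_rep U) < \<infinity>"
  shows "Metric_space S (Sp_dist p)"
proof
  have rep: "\<exists>u. u \<in> Lp_loc_fun p \<and> Sp_enorm p u < \<infinity> \<and> U = ae_class lebesgue u" if US: "U \<in> S" for U
  proof -
    obtain u where u: "u \<in> Lp_loc_fun p" "U = ae_class lebesgue u"
      using S[OF US] by (auto simp: Lp_loc_def)
    have "Sp_enorm p (ae_rep U) = Sp_enorm p u"
      using u by (intro Sp_enorm_cong) (auto intro: AE_ae_rep Lp_loc_fun_shift)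
    with u S[OF US] show ?thesis by auto
  qed
  fix U V W :: "(real \<Rightarrow> 'e) set"
  show "0 \<le> Sp_dist p U V" by (simp add: Sp_dist_def Sp_norm_def)
  show "Sp_dist p U V = Sp_dist p V U"
    unfolding Sp_dist_def Sp_norm_def Sp_enorm_def by (subst Lp_norm_commute) simp
  assume "U \<in> S" "V \<in> S"
  then obtain u v where uv: "u \<in> Lp_loc_fun p" "v \<in> Lp_loc_fun p" "Sp_enorm p u < \<infinity>" "Sp_enorm p v < \<infinity>"
      and UV: "U = ae_class lebesgue u" "V = ae_class lebesgue v"
    using rep by metis
  have fin: "Sp_enorm p (\<lambda>x. u x - v x) < \<infinity>"
    using uv p by (intro Sp_enorm_diff_finite)
  have "Sp_dist p U V = 0 \<longleftrightarrow> Sp_enorm p (\<lambda>x. u x - v x) = 0"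
    using fin by (auto simp: UV Sp_dist_ae_class uv p Sp_norm_def enn2real_eq_0_iff)
  also have "\<dots> \<longleftrightarrow> (\<forall>t. Lp_norm unit_interval p (\<lambda>\<theta>. u (t + \<theta>) - v (t + \<theta>)) = 0)"
  proof -
    have "Sp_enorm p (\<lambda>x. u x - v x) = 0 \<longleftrightarrow> Sp_enorm p (\<lambda>x. u x - v x) \<le> 0" by simp
    also have "\<dots> \<longleftrightarrow> (\<forall>t. Lp_norm unit_interval p (\<lambda>\<theta>. u (t + \<theta>) - v (t + \<theta>)) \<le> 0)"
      unfolding Sp_enorm_def SUP_le_iff by (simp add: ennreal_eq_0_iff)
    finally show ?thesis by (simp add: antisym_conv)
  qed
  also have "\<dots> \<longleftrightarrow> U = V"
    using uv p
    by (simp add: UV ae_class_eq_iff AE_lebesgue_iff_shift unit_interval.Lp_norm_eq_0_iff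
        unit_interval.Lp_minkowski(1) Lp_loc_fun_shift)
  finally show "Sp_dist p U V = 0 \<longleftrightarrow> U = V" .
  assume "W \<in> S"
  then obtain w where w: "w \<in> Lp_loc_fun p" "Sp_enorm p w < \<infinity>" "W = ae_class lebesgue w"
    using rep by metis
  have fin': "Sp_enorm p (\<lambda>x. v x - w x) < \<infinity>"
    using uv w p by (intro Sp_enorm_diff_finite)
  have "enn2real (Sp_enorm p (\<lambda>x. u x - w x)) \<le>
      enn2real (Sp_enorm p (\<lambda>x. u x - v x) + Sp_enorm p (\<lambda>x. v x - w x))"
    using fin fin' uv w p by (intro enn2real_mono Sp_enorm_triangle) auto
  also have "\<dots> = enn2real (Sp_enorm p (\<lambda>x. u x - v x)) + enn2real (Sp_enorm p (\<lambda>x. v x - w x))"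
    using fin fin' by (intro enn2real_plus) auto
  finally show "Sp_dist p U W \<le> Sp_dist p U V + Sp_dist p V W"
    by (simp add: UV w Sp_dist_ae_class uv p Sp_norm_def)
qed

lemma almost_automorphic_bounded:
  assumes "almost_automorphic m u"
  shows "\<exists>B. \<forall>t. mdist m (u t) (u 0) \<le> B"
proof (rule ccontr)
  interpret Metric_space "mspace m" "mdist m" by simp
  assume "\<not> ?thesis"
  then have "\<forall>n. \<exists>t. mdist m (u t) (u 0) > real n" by (meson not_le)
  then obtain s where s: "\<And>n. mdist m (u (s n)) (u 0) > real n" by metis
  obtain r v where r: "strict_mono r"
    and v: "\<And>t. limitin (mtopology_of m) (\<lambda>k. u (t + s (r k))) (v t) sequentially"
    using assms unfolding almost_automorphic_def by blast
  have sp: "u t \<in> mspace m" for t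
    using assms by (auto simp: almost_automorphic_def continuous_map_def)
  have "v 0 \<in> mspace m \<and> (\<exists>N. \<forall>n\<ge>N. mdist m (u (0 + s (r n))) (v 0) < 1)"
    using v[of 0] unfolding mtopology_of_def limit_metric_sequentially
    by (meson zero_less_one)
  then obtain N where v0: "v 0 \<in> mspace m" and N: "\<And>n. n \<ge> N \<Longrightarrow> mdist m (u (s (r n))) (v 0) < 1"
    by auto
  obtain n where n: "real n > 1 + mdist m (v 0) (u 0)" using reals_Archimedean2 by blast
  let ?k = "max N n"
  have "real n \<le> real (r ?k)"
    using seq_suble[OF r, of ?k] by simp
  then have "real n < mdist m (u (s (r ?k))) (u 0)" using s[of "r ?k"] by simp
  also have "\<dots> \<le> mdist m (u (s (r ?k))) (v 0) + mdist m (v 0) (u 0)"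
    by (intro mdist_triangle sp v0)
  also have "\<dots> < 1 + mdist m (v 0) (u 0)" using N[of ?k] by simp
  finally show False using n by simp
qed

lemma almost_periodic_bounded:
  assumes "almost_periodic m u"
  shows "\<exists>B. \<forall>t. mdist m (u t) (u 0) \<le> B"
proof -
  interpret Metric_space "mspace m" "mdist m" by simp
  have cont: "continuous_map euclideanreal (mtopology_of m) u"
    using assms by (simp add: almost_periodic_def)
  then have sp: "u t \<in> mspace m" for t by (auto simp: continuous_map_def)
  have "relatively_dense {\<tau>. (SUP t. ereal (mdist m (u (t + \<tau>)) (u t))) \<le> ereal 1}"
    using assms unfolding almost_periodic_def by (meson zero_less_one)
  then obtain l where l: "l > 0"
    "\<And>a. \<exists>\<tau>\<in>{a..a+l}. \<forall>t. mdist m (u (t + \<tau>)) (u t) \<le> 1"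
    unfolding relatively_dense_def by (fastforce simp: SUP_le_iff)
  have "compactin mtopology (u ` {0..l})"
    using cont by (intro image_compactin[of euclideanreal]) (auto simp: mtopology_of_def)
  then have "mbounded (u ` {0..l})" by (rule compactin_imp_mbounded)
  then obtain c B where B: "u ` {0..l} \<subseteq> mcball c B" by (auto simp: mbounded_def)
  have B': "mdist m (u x) (u 0) \<le> 2 * B" if "x \<in> {0..l}" for x
  proof -
    have "u x \<in> mcball c B" "u 0 \<in> mcball c B"
      using subsetD[OF B imageI[OF that]] subsetD[OF B imageI[of 0]] l by simp_all
    then show ?thesis using mdist_triangle[of "u x" m c "u 0"] commute[of c "u x"] by simp
  qed
  have "mdist m (u t) (u 0) \<le> 1 + 2 * B" for t
  proof -
    obtain \<tau> where \<tau>: "\<tau> \<in> {-t..-t+l}" "\<And>t. mdist m (u (t + \<tau>)) (u t) \<le> 1" using l(2) by blast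
    have "mdist m (u t) (u 0) \<le> mdist m (u t) (u (t + \<tau>)) + mdist m (u (t + \<tau>)) (u 0)"
      by (intro mdist_triangle sp)
    also have "\<dots> \<le> 1 + 2 * B"
      using \<tau>(2)[of t] B'[of "t + \<tau>"] \<tau>(1) by (intro add_mono) (auto simp: commute)
    finally show ?thesis .
  qed
  then show ?thesis by blast
qed

lemma Sp_enorm_finite:
  fixes U :: "(real \<Rightarrow> 'e::real_normed_vector) set"
  assumes U: "U \<in> Lp_loc p" and p: "p \<ge> 1"
    and B: "\<forall>t. mdist (Lp_metric unit_interval p) (bochner_transform U t) (bochner_transform U 0) \<le> B"
  shows "Sp_enorm p (ae_rep U) < \<infinity>"
proof -
  obtain u where u: "u \<in> Lp_loc_fun p" "U = ae_class lebesgue u" using U by (auto simp: Lp_loc_def)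
  let ?N = "Lp_norm unit_interval p"
  have "?N (\<lambda>\<theta>. u (t + \<theta>)) \<le> B + ?N u" for t
  proof -
    have sh: "(\<lambda>\<theta>. u (s + \<theta>)) \<in> Lp_fun unit_interval p" for s using Lp_loc_fun_shift[OF u(1)] .
    have 0: "(\<lambda>\<theta>. 0 :: 'e) \<in> Lp_fun unit_interval p"
      using unit_interval.Lp_minkowski(1)[OF sh[of 0] sh[of 0] p] by simp
    have "?N (\<lambda>\<theta>. u (t + \<theta>) - u (0 + \<theta>)) \<le> B"
      using B p by (simp add: u unit_interval.Lp_metric_simps bochner_transform_ae_class
          unit_interval.Lp_dist_ae_class[OF sh sh, of _ 0, simplified])
    moreover have "?N (\<lambda>\<theta>. u (t + \<theta>) - 0) \<le> ?N (\<lambda>\<theta>. u (t + \<theta>) - u (0 + \<theta>)) + ?N (\<lambda>\<theta>. u (0 + \<theta>) - 0)"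
      by (rule unit_interval.Lp_norm_triangle[OF sh sh 0 p])
    ultimately show ?thesis by simp
  qed
  then have "Sp_enorm p u \<le> ennreal (B + ?N u)"
    unfolding Sp_enorm_def by (intro SUP_least ennreal_leI)
  also have "\<dots> < \<infinity>" by simp
  finally have "Sp_enorm p u < \<infinity>" .
  moreover have "Sp_enorm p (ae_rep U) = Sp_enorm p u"
    using u by (intro Sp_enorm_cong) (auto intro: AE_ae_rep Lp_loc_fun_shift)
  ultimately show ?thesis by simp
qed

lemma Sp_aa_bounded: "U \<in> Sp_aa p \<Longrightarrow> p \<ge> 1 \<Longrightarrow> Sp_enorm p (ae_rep U) < \<infinity>"
  unfolding Sp_aa_def by (blast dest: almost_automorphic_bounded intro: Sp_enorm_finite)

lemma Sp_ap_bounded: "U \<in> Sp_ap p \<Longrightarrow> p \<ge> 1 \<Longrightarrow> Sp_enorm p (ae_rep U) < \<infinity>"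
  unfolding Sp_ap_def by (blast dest: almost_periodic_bounded intro: Sp_enorm_finite)

lemma Metric_space_Sp_aa: "p \<ge> 1 \<Longrightarrow> Metric_space (Sp_aa p) (Sp_dist p)"
  by (intro Metric_space_Sp) (auto intro: Sp_aa_bounded[simplified] simp: Sp_aa_def[of p])

lemma Metric_space_Sp_ap: "p \<ge> 1 \<Longrightarrow> Metric_space (Sp_ap p) (Sp_dist p)"
  by (intro Metric_space_Sp) (auto intro: Sp_ap_bounded[simplified] simp: Sp_ap_def[of p])

lemma Sp_aa_metric_simps:
  assumes "p \<ge> 1"
  shows "mspace (Sp_aa_metric p) = Sp_aa p" "mdist (Sp_aa_metric p) = Sp_dist p"
  unfolding Sp_aa_metric_def
  using Metric_space.mspace_metric[OF Metric_space_Sp_aa[OF assms]]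
        Metric_space.mdist_metric[OF Metric_space_Sp_aa[OF assms]] by auto

lemma Sp_ap_metric_simps:
  assumes "p \<ge> 1"
  shows "mspace (Sp_ap_metric p) = Sp_ap p" "mdist (Sp_ap_metric p) = Sp_dist p"
  unfolding Sp_ap_metric_def
  using Metric_space.mspace_metric[OF Metric_space_Sp_ap[OF assms]]
        Metric_space.mdist_metric[OF Metric_space_Sp_ap[OF assms]] by auto

end

theory Submission
  imports Defs
begin

text \<open>
  The Bochner transform turns the Nemytskii operator into composition with the superposition
  operator \<open>F \<mapsto> f \<circ> F\<close> from \<open>L\<^sup>p(0,1)\<close> to \<open>L\<^sup>q(0,1)\<close>.  A sequence converging in \<open>L\<^sup>p\<close> has a
  subsequence that converges almost everywhere and is dominated in \<open>L\<^sup>p\<close>, so the growth condition and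
  dominated convergence give convergence of the images in \<open>L\<^sup>q\<close>.  As \<open>L\<^sup>p\<close> is complete, the
  superposition operator satisfies a uniform continuity estimate at the points of every totally
  bounded set, the second point being arbitrary.  The ranges of almost periodic and almost automorphic
  functions are totally bounded, hence the operator preserves both classes, and uniformity in the
  translation parameter yields continuity for the Stepanov norms.
\<close>

section \<open>Sequences of functions\<close>

text \<open>Each \<open>P n\<close> can be met beyond any given index, so the indices are chosen
  recursively, each past the one before. Serves to extract subsequences with a prescribed rate of
  convergence.\<close>

lemma strict_mono_eventually:
  assumes "\<And>n. eventually (P n) sequentially"
  obtains r :: "nat \<Rightarrow> nat" where "strict_mono r" "\<And>n. P n (r n)"
proof -
  have "\<exists>r::nat \<Rightarrow> nat. \<forall>n. P n (r n) \<and> r n < r (Suc n)"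
  proof (rule dependent_nat_choice)
    show "\<exists>m. P 0 m"
      using assms[of 0] by (auto simp: eventually_sequentially)
    show "\<exists>m'. P (Suc n) m' \<and> m < m'" for m n
    proof -
      have "eventually (\<lambda>m'. P (Suc n) m' \<and> m < m') sequentially"
        using assms eventually_gt_at_top by (rule eventually_conj)
      then show ?thesis by (auto simp: eventually_sequentially)
    qed
  qed
  then show thesis using that by (auto simp: strict_mono_Suc_iff)
qed

text \<open>The sum is at most twice the maximum. A sharp constant would bring nothing, as the bound
  only serves to build dominating functions.\<close>

lemma powr_add_le_two_powr:
  fixes x y p :: real
  assumes "x \<ge> 0" "y \<ge> 0" "p \<ge> 0"
  shows "(x + y) powr p \<le> 2 powr p * (x powr p + y powr p)"
proof -
  have "(x + y) powr p \<le> (2 * max x y) powr p"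
    using assms by (intro powr_mono2) auto
  also have "\<dots> = 2 powr p * max x y powr p"
    using assms by (simp add: powr_mult)
  also have "max x y powr p \<le> x powr p + y powr p"
    by (simp add: max_def)
  finally show ?thesis by simp
qed

text \<open>The steps from \<open>n\<close> on are dominated by a geometric series with sum
  \<open>2 * K * (1/2) ^ n\<close>, which gives both the Cauchy property and the rate.\<close>

lemma geometric_steps_converge:
  fixes a :: "nat \<Rightarrow> 'e::banach"
  assumes "\<And>n. norm (a (Suc n) - a n) \<le> K * (1/2) ^ n"
  shows "convergent a" and "norm (a n - lim a) \<le> 2 * K * (1/2) ^ n"
proof -
  have K: "K \<ge> 0" using order_trans[OF norm_ge_zero assms[of 0]] by simp
  \<comment> \<open>The right-hand side is the exact sum of \<open>K * (1/2) ^ j\<close> for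
    \<open>n \<le> j < n + k\<close>; keeping the subtracted term lets the induction close.\<close>
  have step: "norm (a (n + k) - a n) \<le> 2 * K * (1/2) ^ n - 2 * K * (1/2) ^ (n + k)" for n k
  proof (induction k)
    case (Suc k)
    have "norm (a (n + Suc k) - a n) \<le> norm (a (Suc (n + k)) - a (n + k)) + norm (a (n + k) - a n)"
      using norm_triangle_ineq[of "a (Suc (n + k)) - a (n + k)" "a (n + k) - a n"] by simp
    with Suc assms[of "n + k"] show ?case by simp
  qed simp
  have bound: "norm (a (n + k) - a n) \<le> 2 * K * (1/2) ^ n" for n k
    using K by (intro order_trans[OF step]) simp
  have "(\<lambda>n. 2 * K * (1/2) ^ n) \<longlonglongrightarrow> 2 * K * 0"
    by (intro tendsto_intros LIMSEQ_power_zero) simp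
  then have "Cauchy a"
    unfolding Cauchy_altdef2
    by (auto dest!: order_tendstoD(2) simp: eventually_sequentially dist_norm)
       (metis bound le_iff_add order_le_less_trans order_refl)
  then show conv: "convergent a" by (simp add: Cauchy_convergent_iff)
  have "(\<lambda>k. a (k + n)) \<longlonglongrightarrow> lim a"
    using conv by (intro LIMSEQ_ignore_initial_segment) (simp add: convergent_LIMSEQ_iff)
  then have "(\<lambda>k. norm (a (n + k) - a n)) \<longlonglongrightarrow> norm (lim a - a n)"
    by (intro tendsto_intros) (simp add: add.commute)
  then have "norm (lim a - a n) \<le> 2 * K * (1/2) ^ n"
    using bound by (intro LIMSEQ_le_const2) auto
  then show "norm (a n - lim a) \<le> 2 * K * (1/2) ^ n" by (simp add: norm_minus_commute)
qed

text \<open>Beppo Levi: sum and integral of nonnegative functions commute, so the pointwise sum has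
  finite integral and is finite almost everywhere.\<close>

lemma integrable_suminf_nonneg:
  fixes g :: "nat \<Rightarrow> 'a \<Rightarrow> real"
  assumes int: "\<And>n. integrable M (g n)" and nonneg: "\<And>n x. 0 \<le> g n x"
    and sum: "summable (\<lambda>n. \<integral>x. g n x \<partial>M)"
  shows "AE x in M. summable (\<lambda>n. g n x)" and "integrable M (\<lambda>x. \<Sum>n. g n x)"
proof -
  have [measurable]: "g n \<in> borel_measurable M" for n using int by simp
  have "(\<integral>\<^sup>+x. (\<Sum>n. ennreal (g n x)) \<partial>M) = (\<Sum>n. ennreal (\<integral>x. g n x \<partial>M))"
    using int nonneg by (simp add: nn_integral_suminf nn_integral_eq_integral)
  also have "\<dots> = ennreal (\<Sum>n. \<integral>x. g n x \<partial>M)"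
    using nonneg sum by (intro suminf_ennreal2) (auto intro: integral_nonneg)
  finally have "AE x in M. (\<Sum>n. ennreal (g n x)) \<noteq> \<infinity>"
    by (intro nn_integral_PInf_AE) auto
  then show ae: "AE x in M. summable (\<lambda>n. g n x)"
    by eventually_elim (intro summable_suminf_not_top, use nonneg in auto)
  show "integrable M (\<lambda>x. \<Sum>n. g n x)"
    using ae nonneg sum int by (intro integrable_suminf) auto
qed

section \<open>Completeness of the Lebesgue--Bochner spaces\<close>

text \<open>Completeness keeps measurability under changes on null sets. Finiteness makes constants
  integrable: the bound 1 of truncated distances and the constant term of the growth
  condition.\<close>

locale complete_finite_measure = complete_measure + finite_measure
begin

text \<open>A diagonal choice: a simple \<open>s n\<close> is taken so close to \<open>u n\<close>
  in measure that the errors are summable. Then \<open>s n x - u n x\<close> tends to 0 almost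
  everywhere, and \<open>s n\<close> itself approximates \<open>v\<close>.\<close>

lemma strongly_measurable_AE_limit:
  fixes u :: "nat \<Rightarrow> 'a \<Rightarrow> 'e::real_normed_vector"
  assumes u: "\<And>n. strongly_measurable M (u n)" and lim: "AE x in M. (\<lambda>n. u n x) \<longlonglongrightarrow> v x"
  shows "strongly_measurable M v"
proof -
  \<comment> \<open>The integral of the truncated distance metrizes convergence in measure.\<close>
  let ?P = "\<lambda>n s. simple_function M s \<and> integrable M (\<lambda>x. min 1 (norm (s x - u n x))) \<and>
    (\<integral>x. min 1 (norm (s x - u n x)) \<partial>M) < (1/2) ^ n"
  have "\<forall>n. \<exists>s. ?P n s"
  proof
    fix n
    obtain s where s: "\<And>k. simple_function M (s k)" "AE x in M. (\<lambda>k. s k x) \<longlonglongrightarrow> u n x"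
      using u[of n] by (auto simp: strongly_measurable_def)
    have "strongly_measurable M (s k)" for k
      using s(1)[of k] unfolding strongly_measurable_def by (intro exI[of _ "\<lambda>_. s k"]) simp
    then have [measurable]: "(\<lambda>x. norm (s k x - u n x)) \<in> borel_measurable M" for k
      using u by (intro strongly_measurable_norm strongly_measurable_diff)
    have int: "integrable M (\<lambda>x. min 1 (norm (s k x - u n x)))" for k
      by (rule integrable_const_bound[where B=1]) auto
    have "AE x in M. (\<lambda>k. min 1 (norm (s k x - u n x))) \<longlonglongrightarrow> 0"
      using s(2)
    proof eventually_elim
      case (elim x)
      then have "(\<lambda>k. min 1 (norm (s k x - u n x))) \<longlonglongrightarrow> min 1 (norm (u n x - u n x))"
        by (intro tendsto_intros)
      then show ?case by simp
    qed
    then have "(\<lambda>k. \<integral>x. min 1 (norm (s k x - u n x)) \<partial>M) \<longlonglongrightarrow> (\<integral>x. 0 \<partial>M)"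
      by (intro integral_dominated_convergence[where w="\<lambda>_. 1"]) auto
    then have "eventually (\<lambda>k. (\<integral>x. min 1 (norm (s k x - u n x)) \<partial>M) < (1/2) ^ n) sequentially"
      by (intro order_tendstoD(2)[of _ 0]) auto
    then obtain k where "(\<integral>x. min 1 (norm (s k x - u n x)) \<partial>M) < (1/2) ^ n"
      by (meson eventually_happens trivial_limit_sequentially)
    with int[of k] s(1)[of k] show "\<exists>s. ?P n s" by blast
  qed
  from choice[OF this] obtain s where "\<forall>n. ?P n (s n)" ..
  then have s: "\<And>n. simple_function M (s n)"
      "\<And>n. integrable M (\<lambda>x. min 1 (norm (s n x - u n x)))"
      "\<And>n. (\<integral>x. min 1 (norm (s n x - u n x)) \<partial>M) < (1/2) ^ n"
    by blast+
  have "summable (\<lambda>n. \<integral>x. min 1 (norm (s n x - u n x)) \<partial>M)"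
    by (rule summable_comparison_test'[OF summable_geometric[of "1/2::real"]])
       (use s(3) in \<open>auto simp: less_imp_le integral_nonneg\<close>)
  then have "AE x in M. summable (\<lambda>n. min 1 (norm (s n x - u n x)))"
    using s(2) by (intro integrable_suminf_nonneg) auto
  then have "AE x in M. (\<lambda>n. s n x) \<longlonglongrightarrow> v x"
    using lim
  proof eventually_elim
    case (elim x)
    have "(\<lambda>n. min 1 (norm (s n x - u n x))) \<longlonglongrightarrow> 0"
      using elim(1) by (rule summable_LIMSEQ_zero)
    \<comment> \<open>Once the truncated distance is below 1, it equals the distance itself.\<close>
    then have "(\<lambda>n. norm (s n x - u n x)) \<longlonglongrightarrow> 0"
    proof (rule Lim_transform_eventually)
      have "eventually (\<lambda>n. min 1 (norm (s n x - u n x)) < 1) sequentially"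
        using \<open>(\<lambda>n. min 1 (norm (s n x - u n x))) \<longlonglongrightarrow> 0\<close> by (rule order_tendstoD) simp
      then show "eventually (\<lambda>n. min 1 (norm (s n x - u n x)) = norm (s n x - u n x)) sequentially"
        by eventually_elim auto
    qed
    then have "(\<lambda>n. (s n x - u n x) + u n x) \<longlonglongrightarrow> 0 + v x"
      using elim(2) by (intro tendsto_add) (simp_all add: tendsto_norm_zero_iff)
    then show ?case by simp
  qed
  with s(1) show ?thesis by (auto simp: strongly_measurable_def)
qed

lemma integral_norm_powr_eq:
  "p > 0 \<Longrightarrow> (\<integral>x. norm (f x) powr p \<partial>M) = Lp_norm M p f powr p"
  by (simp add: Lp_norm_def powr_powr)

text \<open>Riesz-Fischer: a fast Cauchy subsequence converges almost everywhere with an explicit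
  rate, and integrating this rate gives convergence in norm.\<close>

lemma Lp_Cauchy_imp_convergent_subseq:
  fixes u :: "nat \<Rightarrow> 'a \<Rightarrow> 'e::banach"
  assumes u: "\<And>n. u n \<in> Lp_fun M p" and p: "p \<ge> 1"
    and Cauchy: "\<And>e. e > 0 \<Longrightarrow> \<exists>N. \<forall>m\<ge>N. \<forall>n\<ge>N. Lp_norm M p (\<lambda>x. u m x - u n x) < e"
  shows "\<exists>r v. strict_mono r \<and> v \<in> Lp_fun M p \<and> (\<lambda>n. Lp_norm M p (\<lambda>x. u (r n) x - v x)) \<longlonglongrightarrow> 0"
proof -
  \<comment> \<open>The rate 1/4 still leaves a factor \<open>(1/2) ^ n\<close> after multiplication
    by the weight \<open>2 ^ n\<close> in \<open>g\<close> below.\<close>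
  have "eventually (\<lambda>m. \<forall>k\<ge>m. Lp_norm M p (\<lambda>x. u k x - u m x) < (1/4) ^ n) sequentially" for n
    using Cauchy[of "(1/4) ^ n"] unfolding eventually_sequentially by (auto intro: order_trans)
  then obtain r where r: "strict_mono r"
      and rn: "\<And>n. \<forall>k\<ge>r n. Lp_norm M p (\<lambda>x. u k x - u (r n) x) < (1/4) ^ n"
    using strict_mono_eventually[of "\<lambda>n m. \<forall>k\<ge>m. Lp_norm M p (\<lambda>x. u k x - u m x) < (1/4) ^ n"]
    by blast
  define w where "w n = u (r n)" for n
  have w: "w n \<in> Lp_fun M p" for n by (simp add: w_def u)
  have dw: "(\<lambda>x. w m x - w n x) \<in> Lp_fun M p" for m n
    using w w p by (rule Lp_minkowski(1))
  have dw_le: "Lp_norm M p (\<lambda>x. w (Suc n) x - w n x) < (1/4) ^ n" for n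
    using rn[of n] strict_mono_less_eq[OF r, of n "Suc n"] by (simp add: w_def)
  \<comment> \<open>With the weight \<open>2 ^ n\<close>, summability of \<open>g n x\<close> bounds the steps of \<open>w n x\<close> geometrically, so that
    Minkowski's inequality for series is not needed.\<close>
  define g where "g n x = (2 ^ n * norm (w (Suc n) x - w n x)) powr p" for n x
  have g_eq: "g n x = (2 ^ n) powr p * norm (w (Suc n) x - w n x) powr p" for n x
    by (simp add: g_def powr_mult)
  have g_int: "integrable M (g n)" for n
    unfolding g_eq using dw by (intro integrable_mult_right) (simp add: Lp_fun_def)
  have g_le: "(\<integral>x. g n x \<partial>M) \<le> ((1/2) powr p) ^ n" for n
  proof -
    have "(\<integral>x. g n x \<partial>M) = (2 ^ n * Lp_norm M p (\<lambda>x. w (Suc n) x - w n x)) powr p"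
      using p by (simp add: g_eq integral_norm_powr_eq powr_mult)
    also have "\<dots> \<le> (2 ^ n * (1/4) ^ n) powr p"
      using dw_le[of n] p by (intro powr_mono2) auto
    also have "2 ^ n * (1/4) ^ n = (1/2 :: real) ^ n"
      by (simp flip: power_mult_distrib)
    also have "((1/2 :: real) ^ n) powr p = ((1/2) powr p) ^ n"
      by (simp add: powr_power powr_powr mult.commute flip: powr_realpow)
    finally show ?thesis .
  qed
  have "(1/2) powr p < (1::real)" using p powr_less_mono2[of p "1/2" 1] by simp
  then have summ: "summable (\<lambda>n. \<integral>x. g n x \<partial>M)"
    by (intro summable_comparison_test'[OF summable_geometric[of "(1/2) powr p"]])
       (use g_le in \<open>auto simp: g_def integral_nonneg\<close>)
  define H where "H x = (\<Sum>n. g n x)" for x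
  have H: "AE x in M. summable (\<lambda>n. g n x)" "integrable M H"
    unfolding H_def using integrable_suminf_nonneg[OF g_int _ summ] by (auto simp: g_def)
  define v where "v x = lim (\<lambda>n. w n x)" for x
  \<comment> \<open>Since \<open>g n x \<le> H x\<close>, the steps at \<open>x\<close> are at most
    \<open>H x powr (1/p) * (1/2) ^ n\<close>; the factor 2 comes from summing the geometric
    tail.\<close>
  have "AE x in M. (\<lambda>n. w n x) \<longlonglongrightarrow> v x \<and> (\<forall>n. norm (w n x - v x) powr p \<le> (2 * (1/2) ^ n) powr p * H x)"
    using H(1)
  proof eventually_elim
    case (elim x)
    have H0: "H x \<ge> 0" unfolding H_def by (rule suminf_nonneg[OF elim]) (simp add: g_def)
    have "norm (w (Suc n) x - w n x) \<le> H x powr (1/p) * (1/2) ^ n" for n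
    proof -
      have "g n x \<le> H x"
        unfolding H_def using sum_le_suminf[OF elim, of "{n}"] by (simp add: g_def)
      then have "g n x powr (1/p) \<le> H x powr (1/p)"
        using p by (intro powr_mono2) (auto simp: g_def)
      then show ?thesis using p by (simp add: g_def powr_powr field_simps)
    qed
    note conv = geometric_steps_converge[of "\<lambda>n. w n x", OF this]
    have "norm (w n x - v x) powr p \<le> (2 * (1/2) ^ n) powr p * H x" for n
    proof -
      have "norm (w n x - v x) powr p \<le> ((2 * (1/2) ^ n) * H x powr (1/p)) powr p"
        using conv(2)[of n] p by (intro powr_mono2) (auto simp: v_def algebra_simps)
      also have "\<dots> = (2 * (1/2) ^ n) powr p * H x"
        using p H0 by (subst powr_mult) (simp_all add: powr_powr)
      finally show ?thesis .
    qed
    moreover have "(\<lambda>n. w n x) \<longlonglongrightarrow> v x"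
      unfolding v_def using conv(1) by (rule convergent_LIMSEQ_iff[THEN iffD1])
    ultimately show ?case by blast
  qed
  then have lim: "AE x in M. (\<lambda>n. w n x) \<longlonglongrightarrow> v x"
    and bound: "\<And>n. AE x in M. norm (w n x - v x) powr p \<le> (2 * (1/2) ^ n) powr p * H x"
    by (auto simp: AE_all_countable)
  have vm: "strongly_measurable M v"
    using w by (intro strongly_measurable_AE_limit[OF _ lim]) (auto simp: Lp_fun_def)
  have wv: "strongly_measurable M (\<lambda>x. w n x - v x)" for n
    using w[of n] vm by (intro strongly_measurable_diff) (auto simp: Lp_fun_def)
  have [measurable]: "(\<lambda>x. norm (w n x - v x)) \<in> borel_measurable M" for n
    using strongly_measurable_norm[OF wv] .
  have int: "integrable M (\<lambda>x. norm (w n x - v x) powr p)" for n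
    by (rule Bochner_Integration.integrable_bound[OF integrable_mult_right[OF H(2), of "(2 * (1/2) ^ n) powr p"]])
       (use bound[of n] in \<open>auto elim!: eventually_mono intro: order_trans[OF _ abs_ge_self]\<close>)
  \<comment> \<open>Membership of \<open>v\<close> follows by writing it as a difference of two
    members, \<open>w 0\<close> and \<open>w 0 - v\<close>.\<close>
  have "(\<lambda>x. w 0 x - (w 0 x - v x)) \<in> Lp_fun M p"
    using wv[of 0] int[of 0] by (intro Lp_minkowski(1)[OF w[of 0] _ p, of "\<lambda>x. w 0 x - v x"]) (simp add: Lp_fun_def)
  then have v: "v \<in> Lp_fun M p" by simp
  have le: "Lp_norm M p (\<lambda>x. w n x - v x) \<le> (2 * (1/2) ^ n) * (\<integral>x. H x \<partial>M) powr (1/p)" for n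
  proof -
    have "(\<integral>x. norm (w n x - v x) powr p \<partial>M) \<le> (\<integral>x. (2 * (1/2) ^ n) powr p * H x \<partial>M)"
      using bound[of n] H(2) int by (intro integral_mono_AE) auto
    then have "Lp_norm M p (\<lambda>x. w n x - v x) \<le> ((2 * (1/2) ^ n) powr p * (\<integral>x. H x \<partial>M)) powr (1/p)"
      unfolding Lp_norm_def using p by (intro powr_mono2) auto
    also have "\<dots> = ((2 * (1/2) ^ n) powr p) powr (1/p) * (\<integral>x. H x \<partial>M) powr (1/p)"
      by (simp add: powr_mult)
    also have "((2 * (1/2) ^ n) powr p) powr (1/p) = (2 * (1/2) ^ n :: real)"
      using p by (subst powr_powr) simp
    finally show ?thesis .
  qed
  have "(\<lambda>n. (2 * (1/2) ^ n) * (\<integral>x. H x \<partial>M) powr (1/p)) \<longlonglongrightarrow> 2 * 0 * (\<integral>x. H x \<partial>M) powr (1/p)"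
    by (intro tendsto_intros LIMSEQ_power_zero) simp
  then have upper: "(\<lambda>n. (2 * (1/2) ^ n) * (\<integral>x. H x \<partial>M) powr (1/p)) \<longlonglongrightarrow> 0" by simp
  have "(\<lambda>n. Lp_norm M p (\<lambda>x. w n x - v x)) \<longlonglongrightarrow> 0"
    by (rule tendsto_sandwich[OF _ _ tendsto_const upper])
       (use le in \<open>simp_all only: Lp_norm_nonneg eventually_True\<close>)
  with r v show ?thesis unfolding w_def by blast
qed

end

lemma mtopology_of_continuous_map:
  "continuous_map (mtopology_of m) (mtopology_of m') g \<longleftrightarrow>
    g \<in> mspace m \<rightarrow> mspace m' \<and>
    (\<forall>x\<in>mspace m. \<forall>e>0. \<exists>d>0. \<forall>y\<in>mspace m. mdist m x y < d \<longrightarrow> mdist m' (g x) (g y) < e)"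
  using Metric_space.metric_continuous_map[OF Metric_space_mspace_mdist[of m] Metric_space_mspace_mdist[of m'], of g]
  unfolding mtopology_of_def image_subset_iff_funcset Ball_def imp_conjL .

section \<open>Superposition operators on Lebesgue--Bochner spaces\<close>

text \<open>Any map sends simple functions to simple functions; continuity is needed only for the
  limit.\<close>

lemma strongly_measurable_compose:
  fixes f :: "'d::real_normed_vector \<Rightarrow> 'e::real_normed_vector"
  assumes "strongly_measurable M u" "continuous_on UNIV f"
  shows "strongly_measurable M (f \<circ> u)"
proof -
  obtain s where s: "\<And>n. simple_function M (s n)" "AE x in M. (\<lambda>n. s n x) \<longlonglongrightarrow> u x"
    using assms(1) by (auto simp: strongly_measurable_def)
  have "AE x in M. (\<lambda>n. (f \<circ> s n) x) \<longlonglongrightarrow> (f \<circ> u) x"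
    using s(2)
  proof eventually_elim
    case (elim x)
    with assms(2) show ?case
      by (auto simp: continuous_on_eq_continuous_at intro: isCont_tendsto_compose)
  qed
  with s(1) show ?thesis
    unfolding strongly_measurable_def
    by (intro exI[of _ "\<lambda>n. f \<circ> s n"]) (auto intro: simple_function_compose)
qed

text \<open>For Lebesgue measure on the line this is \<open>nemytskii\<close>. Over
  \<open>unit_interval\<close> it acts on the single values of a Bochner transform.\<close>

definition superposition :: "'a measure \<Rightarrow> ('d \<Rightarrow> 'e) \<Rightarrow> ('a \<Rightarrow> 'd) set \<Rightarrow> ('a \<Rightarrow> 'e) set" where
  "superposition M f F = ae_class M (f \<circ> ae_rep F)"

lemma superposition_ae_class: "superposition M f (ae_class M u) = ae_class M (f \<circ> u)"
  unfolding superposition_def ae_class_eq_iff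
  using AE_ae_rep[of u M] by (auto elim: eventually_mono)

lemma (in complete_measure) ae_rep_Lp: "F \<in> Lp M p \<Longrightarrow> ae_rep F \<in> Lp_fun M p"
  by (auto simp: Lp_def intro: ae_rep_Lp_fun)

section \<open>Superposition under the growth condition\<close>

locale growth_condition =
  fixes f :: "'x::banach \<Rightarrow> 'y::banach" and p q a b :: real
  assumes p: "1 \<le> p" and q: "1 \<le> q" and cont: "continuous_on UNIV f"
    and a: "a > 0" and b: "b > 0"
    and growth: "\<And>x. norm (f x) \<le> a * norm x powr (p / q) + b"
begin

text \<open>Raising to the power \<open>q\<close> turns the exponent \<open>p / q\<close> into
  \<open>p\<close>. This is what carries L^p into L^q, and it supplies the dominating
  functions.\<close>

lemma growth_powr:
  "norm (f x) powr q \<le> 2 powr q * (a powr q * norm x powr p + b powr q)"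
proof -
  have "norm (f x) powr q \<le> (a * norm x powr (p / q) + b) powr q"
    using growth q by (intro powr_mono2) auto
  also have "\<dots> \<le> 2 powr q * ((a * norm x powr (p / q)) powr q + b powr q)"
    using a b q by (intro powr_add_le_two_powr) auto
  also have "(a * norm x powr (p / q)) powr q = a powr q * norm x powr p"
    using a q by (simp add: powr_mult powr_powr)
  finally show ?thesis .
qed

lemma compose_Lp_fun:
  assumes "complete_finite_measure M" "u \<in> Lp_fun M p"
  shows "f \<circ> u \<in> Lp_fun M q"
proof -
  interpret complete_finite_measure M by fact
  have sm: "strongly_measurable M (f \<circ> u)"
    using assms(2) cont by (intro strongly_measurable_compose) (auto simp: Lp_fun_def)
  have [measurable]: "(\<lambda>x. norm (f (u x))) \<in> borel_measurable M"
    using strongly_measurable_norm[OF sm] by simp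
  have "integrable M (\<lambda>x. 2 powr q * (a powr q * norm (u x) powr p + b powr q))"
    using assms(2) by (auto simp: Lp_fun_def intro!: Bochner_Integration.integrable_add integrable_mult_right)
  then have "integrable M (\<lambda>x. norm (f (u x)) powr q)"
    by (rule Bochner_Integration.integrable_bound)
       (use order_trans[OF growth_powr abs_ge_self] in auto)
  with sm show ?thesis by (simp add: Lp_fun_def)
qed

text \<open>Along a subsequence with summable p-th powers of the distances, convergence holds almost
  everywhere under a common integrable bound, so dominated convergence applies. A subsequence is
  enough, as the result only enters an argument by contradiction.\<close>

lemma Lp_norm_compose_subseq:
  assumes "complete_finite_measure M" and w: "\<And>n. w n \<in> Lp_fun M p" and v: "v \<in> Lp_fun M p"
    and lim: "(\<lambda>n. Lp_norm M p (\<lambda>x. w n x - v x)) \<longlonglongrightarrow> 0"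
  shows "\<exists>r. strict_mono r \<and> (\<lambda>n. Lp_norm M q (\<lambda>x. (f \<circ> w (r n)) x - (f \<circ> v) x)) \<longlonglongrightarrow> 0"
proof -
  interpret complete_finite_measure M by fact
  have int: "integrable M (\<lambda>x. norm (w n x - v x) powr p)" for n
    using Lp_minkowski(1)[OF w v p, of n] by (simp add: Lp_fun_def)
  have "(\<lambda>n. Lp_norm M p (\<lambda>x. w n x - v x) powr p) \<longlonglongrightarrow> 0"
    using p by (intro tendsto_zero_powrI[OF lim tendsto_const]) auto
  then have "(\<lambda>n. \<integral>x. norm (w n x - v x) powr p \<partial>M) \<longlonglongrightarrow> 0"
    using p by (simp add: integral_norm_powr_eq)
  then have "eventually (\<lambda>m. (\<integral>x. norm (w m x - v x) powr p \<partial>M) < (1/2) ^ n) sequentially" for n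
    by (rule order_tendstoD) simp
  then obtain r where r: "strict_mono r"
      "\<And>n. (\<integral>x. norm (w (r n) x - v x) powr p \<partial>M) < (1/2) ^ n"
    using strict_mono_eventually[of "\<lambda>n m. (\<integral>x. norm (w m x - v x) powr p \<partial>M) < (1/2) ^ n"] by blast
  have summ: "summable (\<lambda>n. \<integral>x. norm (w (r n) x - v x) powr p \<partial>M)"
    by (rule summable_comparison_test'[OF summable_geometric[of "1/2::real"]])
       (use r(2) in \<open>auto simp: less_imp_le integral_nonneg\<close>)
  \<comment> \<open>The sum \<open>h\<close> has two uses: its convergence forces the terms to 0
    almost everywhere, and it dominates all of them at once.\<close>
  define h where "h x = (\<Sum>n. norm (w (r n) x - v x) powr p)" for x
  have h: "AE x in M. summable (\<lambda>n. norm (w (r n) x - v x) powr p)" "integrable M h"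
    unfolding h_def using integrable_suminf_nonneg[OF int _ summ] by auto
  \<comment> \<open>\<open>k\<close> bounds \<open>norm (w (r n) x) powr p\<close> for all
    \<open>n\<close>. \<open>B\<close> then arises from splitting the difference of images by
    \<open>powr_add_le_two_powr\<close> and applying \<open>growth_powr\<close> to each
    part.\<close>
  define k where "k x = 2 powr p * (norm (v x) powr p + h x)" for x
  define B where "B x = 2 powr q * (2 powr q * (a powr q * k x + b powr q) +
      2 powr q * (a powr q * norm (v x) powr p + b powr q))" for x
  have "integrable M B"
    unfolding B_def k_def using h(2) v
    by (auto simp: Lp_fun_def intro!: Bochner_Integration.integrable_add integrable_mult_right)
  have "AE x in M. (\<lambda>n. norm (f (w (r n) x) - f (v x)) powr q) \<longlonglongrightarrow> 0 \<and>
      (\<forall>n. norm (f (w (r n) x) - f (v x)) powr q \<le> B x)"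
    using h(1)
  proof eventually_elim
    case (elim x)
    have "(\<lambda>n. (norm (w (r n) x - v x) powr p) powr (1/p)) \<longlonglongrightarrow> 0"
      using p by (intro tendsto_zero_powrI[OF summable_LIMSEQ_zero[OF elim] tendsto_const]) auto
    moreover have "(norm (w (r n) x - v x) powr p) powr (1/p) = norm (w (r n) x - v x)" for n
      using p by (simp add: powr_powr)
    ultimately have "(\<lambda>n. norm (w (r n) x - v x)) \<longlonglongrightarrow> 0" by (simp only:)
    then have "(\<lambda>n. w (r n) x) \<longlonglongrightarrow> v x"
      by (rule LIM_zero_cancel[OF tendsto_norm_zero_cancel])
    then have "(\<lambda>n. f (w (r n) x)) \<longlonglongrightarrow> f (v x)"
      using cont by (auto simp: continuous_on_eq_continuous_at intro: isCont_tendsto_compose)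
    then have "(\<lambda>n. norm (f (w (r n) x) - f (v x))) \<longlonglongrightarrow> 0"
      by (rule tendsto_norm_zero[OF LIM_zero])
    then have 1: "(\<lambda>n. norm (f (w (r n) x) - f (v x)) powr q) \<longlonglongrightarrow> 0"
      using q by (intro tendsto_zero_powrI[OF _ tendsto_const]) auto
    have "norm (f (w (r n) x) - f (v x)) powr q \<le> B x" for n
    proof -
      have "norm (w (r n) x) powr p \<le> (norm (v x) + norm (w (r n) x - v x)) powr p"
        using p norm_triangle_sub by (intro powr_mono2) auto
      also have "\<dots> \<le> 2 powr p * (norm (v x) powr p + norm (w (r n) x - v x) powr p)"
        using p by (intro powr_add_le_two_powr) auto
      also have "norm (w (r n) x - v x) powr p \<le> h x"
        unfolding h_def using sum_le_suminf[OF elim, of "{n}"] by simp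
      finally have w_le: "norm (w (r n) x) powr p \<le> k x" by (simp add: k_def)
      have "norm (f (w (r n) x) - f (v x)) powr q \<le> (norm (f (w (r n) x)) + norm (f (v x))) powr q"
        using q norm_triangle_ineq4 by (intro powr_mono2) auto
      also have "\<dots> \<le> 2 powr q * (norm (f (w (r n) x)) powr q + norm (f (v x)) powr q)"
        using q by (intro powr_add_le_two_powr) auto
      also have "norm (f (w (r n) x)) powr q \<le> 2 powr q * (a powr q * norm (w (r n) x) powr p + b powr q)"
        by (rule growth_powr)
      also have "norm (w (r n) x) powr p \<le> k x" by (rule w_le)
      also have "norm (f (v x)) powr q \<le> 2 powr q * (a powr q * norm (v x) powr p + b powr q)"
        by (rule growth_powr)
      finally show ?thesis by (simp add: B_def mult_left_mono)
    qed
    with 1 show ?case by blast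
  qed
  then have lim0: "AE x in M. (\<lambda>n. norm (f (w (r n) x) - f (v x)) powr q) \<longlonglongrightarrow> 0"
    and bound: "\<And>n. AE x in M. norm (f (w (r n) x) - f (v x)) powr q \<le> B x"
    by (auto simp: AE_all_countable)
  have fw: "(\<lambda>x. (f \<circ> w (r n)) x - (f \<circ> v) x) \<in> Lp_fun M q" for n
    by (rule Lp_minkowski(1)[OF compose_Lp_fun[OF assms(1) w] compose_Lp_fun[OF assms(1) v] q])
  have "(\<lambda>n. \<integral>x. norm (f (w (r n) x) - f (v x)) powr q \<partial>M) \<longlonglongrightarrow> (\<integral>x. 0 \<partial>M)"
  proof (rule integral_dominated_convergence)
    show "integrable M B" by fact
    show "(\<lambda>x. norm (f (w (r n) x) - f (v x)) powr q) \<in> borel_measurable M" for n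
      using fw[of n] by (auto simp: Lp_fun_def)
    show "AE x in M. (\<lambda>n. norm (f (w (r n) x) - f (v x)) powr q) \<longlonglongrightarrow> 0" by (rule lim0)
    show "AE x in M. norm (norm (f (w (r n) x) - f (v x)) powr q) \<le> B x" for n
      using bound[of n] by simp
  qed simp
  then have "(\<lambda>n. Lp_norm M q (\<lambda>x. (f \<circ> w (r n)) x - (f \<circ> v) x)) \<longlonglongrightarrow> 0"
    unfolding Lp_norm_def using q by (intro tendsto_zero_powrI[OF _ tendsto_const]) auto
  with r(1) show ?thesis by blast
qed

lemma superposition_Lp:
  "complete_finite_measure M \<Longrightarrow> F \<in> Lp M p \<Longrightarrow> superposition M f F \<in> Lp M q"
  by (auto simp: Lp_def superposition_ae_class intro: compose_Lp_fun)

text \<open>If no \<open>d\<close> worked, there would be \<open>F n\<close> in \<open>K\<close> and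
  \<open>G n\<close> ever closer to it with images at least \<open>e\<close> apart. Total
  boundedness and completeness make a subsequence of \<open>F\<close> converge to some
  \<open>v\<close>, whose class need not lie in \<open>K\<close>; \<open>G\<close> follows it, and
  both images approach \<open>f \<circ> v\<close>. Leaving \<open>G\<close> free in L^p is what
  later permits arbitrary perturbations.\<close>

lemma superposition_uniform:
  assumes M: "complete_finite_measure M"
    and K: "Metric_space.mtotally_bounded (Lp M p) (Lp_dist M p) K" and e: "e > 0"
  shows "\<exists>d>0. \<forall>F\<in>K. \<forall>G\<in>Lp M p. Lp_dist M p F G < d \<longrightarrow>
           Lp_dist M q (superposition M f F) (superposition M f G) < e"
proof (rule ccontr)
  interpret complete_finite_measure M by fact
  interpret P: Metric_space "Lp M p :: ('a \<Rightarrow> 'x) set set" "Lp_dist M p"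
    using p by (rule Metric_space_Lp)
  assume "\<not> ?thesis"
  then have "\<exists>F G. F \<in> K \<and> G \<in> Lp M p \<and> Lp_dist M p F G < inverse (real (Suc n)) \<and>
      \<not> Lp_dist M q (superposition M f F) (superposition M f G) < e" for n
    by (metis inverse_positive_iff_positive of_nat_0_less_iff zero_less_Suc)
  then obtain F G where FG: "\<And>n. F n \<in> K" "\<And>n. G n \<in> Lp M p"
      "\<And>n. Lp_dist M p (F n) (G n) < inverse (real (Suc n))"
      "\<And>n. \<not> Lp_dist M q (superposition M f (F n)) (superposition M f (G n)) < e"
    by metis
  obtain r where r: "strict_mono r" "P.MCauchy (F \<circ> r)"
    using K FG(1) unfolding P.mtotally_bounded_sequentially by (metis image_subsetI)
  have FM: "F n \<in> Lp M p" for n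
    using FG(1) P.mtotally_bounded_imp_subset[OF K] by blast
  have repF: "ae_rep (F n) \<in> Lp_fun M p" and repG: "ae_rep (G n) \<in> Lp_fun M p" for n
    using FM FG(2) by (auto intro: ae_rep_Lp)
  have "\<exists>N. \<forall>m\<ge>N. \<forall>n\<ge>N. Lp_norm M p (\<lambda>x. ae_rep (F (r m)) x - ae_rep (F (r n)) x) < e" if "e > 0" for e
    using r(2) that unfolding P.MCauchy_def Lp_dist_def by simp
  from Lp_Cauchy_imp_convergent_subseq[OF repF p this]
  obtain r' v where r': "strict_mono r'" and v: "v \<in> Lp_fun M p"
    and limF: "(\<lambda>n. Lp_norm M p (\<lambda>x. ae_rep (F (r (r' n))) x - v x)) \<longlonglongrightarrow> 0"
    by blast
  have FG0: "(\<lambda>n. Lp_dist M p (F n) (G n)) \<longlonglongrightarrow> 0"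
    by (rule tendsto_sandwich[OF _ _ tendsto_const LIMSEQ_inverse_real_of_nat])
       (use FG(3) in \<open>auto simp: less_imp_le\<close>)
  have limG: "(\<lambda>n. Lp_norm M p (\<lambda>x. ae_rep (G (r (r' n))) x - v x)) \<longlonglongrightarrow> 0"
  proof (rule tendsto_sandwich[OF _ _ tendsto_const])
    have "strict_mono (r \<circ> r')" using r(1) r' by (rule strict_mono_o)
    from tendsto_add[OF LIMSEQ_subseq_LIMSEQ[OF FG0 this] limF]
    show "(\<lambda>n. Lp_dist M p (F (r (r' n))) (G (r (r' n))) +
        Lp_norm M p (\<lambda>x. ae_rep (F (r (r' n))) x - v x)) \<longlonglongrightarrow> 0"
      by (simp add: o_def)
    show "\<forall>\<^sub>F n in sequentially. Lp_norm M p (\<lambda>x. ae_rep (G (r (r' n))) x - v x) \<le>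
        Lp_dist M p (F (r (r' n))) (G (r (r' n))) + Lp_norm M p (\<lambda>x. ae_rep (F (r (r' n))) x - v x)"
      using Lp_norm_triangle[OF repG repF v p]
      by (simp add: Lp_dist_def Lp_norm_commute[of M p "ae_rep (F _)" "ae_rep (G _)"])
  qed simp
  obtain s where s: "strict_mono s"
    and s_lim: "(\<lambda>n. Lp_norm M q (\<lambda>x. (f \<circ> ae_rep (F (r (r' (s n))))) x - (f \<circ> v) x)) \<longlonglongrightarrow> 0"
    using Lp_norm_compose_subseq[OF M repF v limF] by blast
  \<comment> \<open>The second extraction runs inside the first, so that both image sequences
    converge along the common index \<open>j\<close>.\<close>
  obtain s' where s': "strict_mono s'"
    and s'_lim: "(\<lambda>n. Lp_norm M q (\<lambda>x. (f \<circ> ae_rep (G (r (r' (s (s' n)))))) x - (f \<circ> v) x)) \<longlonglongrightarrow> 0"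
    using Lp_norm_compose_subseq[OF M repG v LIMSEQ_subseq_LIMSEQ[OF limG s, unfolded o_def]] by blast
  define j where "j n = r (r' (s (s' n)))" for n
  have "(\<lambda>n. Lp_norm M q (\<lambda>x. (f \<circ> ae_rep (F (j n))) x - (f \<circ> v) x) +
             Lp_norm M q (\<lambda>x. (f \<circ> ae_rep (G (j n))) x - (f \<circ> v) x)) \<longlonglongrightarrow> 0 + 0"
    unfolding j_def using LIMSEQ_subseq_LIMSEQ[OF s_lim s'] s'_lim
    by (intro tendsto_add) (simp_all add: o_def)
  then have "\<forall>\<^sub>F n in sequentially. Lp_norm M q (\<lambda>x. (f \<circ> ae_rep (F (j n))) x - (f \<circ> v) x) +
             Lp_norm M q (\<lambda>x. (f \<circ> ae_rep (G (j n))) x - (f \<circ> v) x) < e"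
    using e by (intro order_tendstoD(2)) simp_all
  then obtain n where n: "Lp_norm M q (\<lambda>x. (f \<circ> ae_rep (F (j n))) x - (f \<circ> v) x) +
             Lp_norm M q (\<lambda>x. (f \<circ> ae_rep (G (j n))) x - (f \<circ> v) x) < e"
    by (auto simp: eventually_sequentially)
  note comp = compose_Lp_fun[OF M]
  have "Lp_dist M q (superposition M f (F (j n))) (superposition M f (G (j n))) =
      Lp_norm M q (\<lambda>x. (f \<circ> ae_rep (F (j n))) x - (f \<circ> ae_rep (G (j n))) x)"
    unfolding superposition_def by (rule Lp_dist_ae_class[OF comp[OF repF] comp[OF repG] q])
  also have "\<dots> \<le> Lp_norm M q (\<lambda>x. (f \<circ> ae_rep (F (j n))) x - (f \<circ> v) x) +
             Lp_norm M q (\<lambda>x. (f \<circ> v) x - (f \<circ> ae_rep (G (j n))) x)"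
    by (rule Lp_norm_triangle[OF comp[OF repF] comp[OF v] comp[OF repG] q])
  also have "\<dots> < e" using n by (simp only: Lp_norm_commute[of M q "f \<circ> v"])
  finally show False using FG(4) by blast
qed

text \<open>Continuity at \<open>F\<close> is the uniform estimate for the totally bounded set
  \<open>{F}\<close>.\<close>

lemma continuous_map_superposition:
  assumes M: "complete_finite_measure M"
  shows "continuous_map (mtopology_of (Lp_metric M p)) (mtopology_of (Lp_metric M q)) (superposition M f)"
proof -
  interpret complete_finite_measure M by fact
  interpret P: Metric_space "Lp M p :: ('a \<Rightarrow> 'x) set set" "Lp_dist M p"
    using p by (rule Metric_space_Lp)
  have "\<exists>d>0. \<forall>G\<in>Lp M p. Lp_dist M p F G < d \<longrightarrow> Lp_dist M q (superposition M f F) (superposition M f G) < e"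
    if "F \<in> Lp M p" "e > 0" for F and e :: real
    using superposition_uniform[OF M, of "{F}" e] that by simp
  then show ?thesis
    using superposition_Lp[OF M] by (simp add: mtopology_of_continuous_map Lp_metric_simps p q)
qed

end

section \<open>Almost periodic and almost automorphic functions\<close>

text \<open>A sequence in the range is \<open>u\<close> along some real sequence; the defining
  property at \<open>t = 0\<close> gives a convergent, hence Cauchy, subsequence.\<close>

lemma almost_automorphic_mtotally_bounded:
  assumes "almost_automorphic m u"
  shows "Metric_space.mtotally_bounded (mspace m) (mdist m) (range u)"
proof -
  interpret Metric_space "mspace m" "mdist m" by simp
  have sp: "range u \<subseteq> mspace m"
    using assms by (auto simp: almost_automorphic_def continuous_map_def)
  show ?thesis
    unfolding mtotally_bounded_sequentially
  proof (intro conjI sp allI impI)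
    fix \<sigma> :: "nat \<Rightarrow> 'a" assume \<sigma>: "range \<sigma> \<subseteq> range u"
    then have "\<forall>n. \<exists>t. \<sigma> n = u t" by auto
    then obtain s where s: "\<And>n. \<sigma> n = u (s n)" by metis
    obtain r v where r: "strict_mono r"
      and v: "\<And>t. limitin (mtopology_of m) (\<lambda>k. u (t + s (r k))) (v t) sequentially"
      using assms unfolding almost_automorphic_def by blast
    have "MCauchy (\<sigma> \<circ> r)"
      using v[of 0] sp \<sigma> s by (intro convergent_imp_MCauchy[of _ "v 0"]) (auto simp: mtopology_of_def o_def)
    with r show "\<exists>r. strict_mono r \<and> MCauchy (\<sigma> \<circ> r)" by blast
  qed
qed

lemma almost_periodic_iff:
  "almost_periodic m u \<longleftrightarrow> continuous_map euclideanreal (mtopology_of m) u \<and>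
     (\<forall>\<epsilon>>0. relatively_dense {\<tau>. \<forall>t. mdist m (u (t + \<tau>)) (u t) \<le> \<epsilon>})"
  by (simp add: almost_periodic_def SUP_le_iff)

lemma relatively_dense_mono:
  assumes "relatively_dense T" "T \<subseteq> T'"
  shows "relatively_dense T'"
proof -
  obtain l where l: "l > 0" "\<forall>a. T \<inter> {a..a + l} \<noteq> {}"
    using assms(1) by (auto simp: relatively_dense_def)
  have "T' \<inter> {a..a + l} \<noteq> {}" for a
    using l(2)[rule_format, of a] assms(2) by blast
  with l(1) show ?thesis by (auto simp: relatively_dense_def)
qed

lemma almost_periodicD:
  "almost_periodic m u \<Longrightarrow> \<epsilon> > 0 \<Longrightarrow> relatively_dense {\<tau>. \<forall>t. mdist m (u (t + \<tau>)) (u t) \<le> \<epsilon>}"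
  unfolding almost_periodic_iff by blast

lemma almost_periodic_mtotally_bounded:
  assumes "almost_periodic m u"
  shows "Metric_space.mtotally_bounded (mspace m) (mdist m) (range u)"
proof -
  interpret Metric_space "mspace m" "mdist m" by simp
  have cont: "continuous_map euclideanreal mtopology u"
    using assms by (simp add: almost_periodic_def mtopology_of_def)
  then have sp: "u t \<in> mspace m" for t by (auto simp: continuous_map_def)
  show ?thesis
    unfolding mtotally_bounded_def
  proof (intro allI impI)
    fix e :: real assume e: "e > 0"
    then have "relatively_dense {\<tau>. \<forall>t. mdist m (u (t + \<tau>)) (u t) \<le> e / 2}"
      by (intro almost_periodicD[OF assms]) simp
    then obtain l where l: "\<And>a. \<exists>\<tau>\<in>{a..a+l}. \<forall>t. mdist m (u (t + \<tau>)) (u t) \<le> e / 2"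
      unfolding relatively_dense_def by blast
    have "compactin mtopology (u ` {0..l})"
      using cont by (intro image_compactin[of euclideanreal]) auto
    then have "mtotally_bounded (u ` {0..l})" by (rule compactin_imp_mtotally_bounded)
    then obtain K where K: "finite K" "K \<subseteq> u ` {0..l}" "u ` {0..l} \<subseteq> (\<Union>x\<in>K. mball x (e / 2))"
      using e unfolding mtotally_bounded_def by (meson half_gt_zero)
    have "\<exists>x\<in>K. u t \<in> mball x e" for t
    proof -
      \<comment> \<open>The window is chosen so that \<open>t + \<tau>\<close> lies in
        \<open>{0..l}\<close>.\<close>
      obtain \<tau> where \<tau>: "\<tau> \<in> {-t..-t+l}" "mdist m (u (t + \<tau>)) (u t) \<le> e / 2" using l by blast
      then have "u (t + \<tau>) \<in> u ` {0..l}" by (intro imageI) auto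
      then obtain x where x: "x \<in> K" "x \<in> mspace m" "mdist m x (u (t + \<tau>)) < e / 2"
        using K(3) by fastforce
      have "mdist m x (u t) \<le> mdist m x (u (t + \<tau>)) + mdist m (u (t + \<tau>)) (u t)"
        by (intro mdist_triangle sp x)
      with x \<tau> sp show ?thesis by (intro bexI[of _ x]) auto
    qed
    with K(1,2) show "\<exists>K. finite K \<and> K \<subseteq> range u \<and> range u \<subseteq> (\<Union>x\<in>K. mball x e)"
      by (intro exI[of _ K]) auto
  qed
qed

text \<open>Both defining limits are pointwise in \<open>t\<close>, so sequential continuity
  suffices, with \<open>g (v t)\<close> as the new limit function.\<close>

lemma almost_automorphic_compose:
  assumes u: "almost_automorphic m u" and g: "continuous_map (mtopology_of m) (mtopology_of m') g"
  shows "almost_automorphic m' (\<lambda>t. g (u t))"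
  unfolding almost_automorphic_def
proof (intro conjI allI)
  show "continuous_map euclideanreal (mtopology_of m') (\<lambda>t. g (u t))"
    using u continuous_map_compose[OF _ g, of euclideanreal u]
    by (simp add: almost_automorphic_def o_def)
  fix s :: "nat \<Rightarrow> real"
  obtain r v where "strict_mono r" and
    "\<And>t. limitin (mtopology_of m) (\<lambda>k. u (t + s (r k))) (v t) sequentially"
    "\<And>t. limitin (mtopology_of m) (\<lambda>k. v (t - s (r k))) (u t) sequentially"
    using u unfolding almost_automorphic_def by blast
  then show "\<exists>r. strict_mono r \<and>
      (\<exists>w. \<forall>t. limitin (mtopology_of m') (\<lambda>k. g (u (t + s (r k)))) (w t) sequentially \<and>
               limitin (mtopology_of m') (\<lambda>k. w (t - s (r k))) (g (u t)) sequentially)"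
    by (intro exI[of _ r] conjI exI[of _ "\<lambda>t. g (v t)"] allI
        continuous_map_limit[OF g, unfolded o_def])
qed

text \<open>Almost periods must work for all \<open>t\<close> at once, hence the uniform continuity
  of \<open>g\<close> on the range.\<close>

lemma almost_periodic_compose:
  assumes u: "almost_periodic m u" and g: "continuous_map (mtopology_of m) (mtopology_of m') g"
    and unif: "\<And>e. e > 0 \<Longrightarrow>
      \<exists>d>0. \<forall>x\<in>range u. \<forall>y\<in>range u. mdist m x y < d \<longrightarrow> mdist m' (g x) (g y) < e"
  shows "almost_periodic m' (\<lambda>t. g (u t))"
  unfolding almost_periodic_iff
proof (intro conjI allI impI)
  show "continuous_map euclideanreal (mtopology_of m') (\<lambda>t. g (u t))"
    using u continuous_map_compose[OF _ g, of euclideanreal u]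
    by (simp add: almost_periodic_def o_def)
  fix e :: real assume "e > 0"
  from unif[OF this] obtain d where d: "d > 0"
      "\<forall>x\<in>range u. \<forall>y\<in>range u. mdist m x y < d \<longrightarrow> mdist m' (g x) (g y) < e"
    by (elim exE conjE)
  \<comment> \<open>Halving \<open>d\<close> turns the non-strict bound of almost periods into the
    strict one required by \<open>d\<close>.\<close>
  have "relatively_dense {\<tau>. \<forall>t. mdist m (u (t + \<tau>)) (u t) \<le> d / 2}"
    using d(1) by (intro almost_periodicD[OF u]) simp
  moreover have "{\<tau>. \<forall>t. mdist m (u (t + \<tau>)) (u t) \<le> d / 2} \<subseteq>
      {\<tau>. \<forall>t. mdist m' (g (u (t + \<tau>))) (g (u t)) \<le> e}"
  proof (intro Collect_mono impI allI)
    fix \<tau> t assume "\<forall>t. mdist m (u (t + \<tau>)) (u t) \<le> d / 2"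
    then have "mdist m (u (t + \<tau>)) (u t) < d"
      using d(1) by (auto intro: le_less_trans[of _ "d / 2"])
    with d(2) show "mdist m' (g (u (t + \<tau>))) (g (u t)) \<le> e"
      by (simp add: less_imp_le)
  qed
  ultimately show "relatively_dense {\<tau>. \<forall>t. mdist m' (g (u (t + \<tau>))) (g (u t)) \<le> e}"
    by (rule relatively_dense_mono)
qed

section \<open>The Nemytskii operator on Stepanov spaces\<close>

lemma complete_finite_measure_lebesgue_on:
  "S \<in> lmeasurable \<Longrightarrow> complete_finite_measure (lebesgue_on S)"
  by (simp add: complete_finite_measure_def complete_measure_lebesgue_on finite_measure_lebesgue_on fmeasurableD)

lemma bochner_transform_Lp: "U \<in> Lp_loc p \<Longrightarrow> bochner_transform U t \<in> Lp unit_interval p"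
  by (auto simp: Lp_loc_def bochner_transform_ae_class Lp_def intro: Lp_loc_fun_shift)

text \<open>The Stepanov distance is built from the supremum over \<open>t\<close> of the right-hand
  side, so it measures the uniform distance of Bochner transforms.\<close>

lemma Lp_dist_bochner_transform:
  assumes "U \<in> Lp_loc p" "V \<in> Lp_loc p" "p \<ge> 1"
  shows "Lp_dist unit_interval p (bochner_transform U t) (bochner_transform V t) =
    Lp_norm unit_interval p (\<lambda>\<theta>. ae_rep U (t + \<theta>) - ae_rep V (t + \<theta>))"
proof -
  have "ae_rep W \<in> Lp_loc_fun p" if "W \<in> Lp_loc p" for W :: "(real \<Rightarrow> 'a) set"
    using that by (auto simp: Lp_loc_def intro: ae_rep_Lp_loc_fun)
  then show ?thesis
    unfolding bochner_transform_def
    using assms by (intro unit_interval.Lp_dist_ae_class Lp_loc_fun_shift)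
qed

section \<open>Invariance of the Stepanov classes and continuity\<close>

context growth_condition
begin

lemma nemytskii_Lp_loc:
  assumes "U \<in> Lp_loc p"
  shows "nemytskii f U \<in> Lp_loc q"
proof -
  obtain u where u: "u \<in> Lp_loc_fun p" "U = ae_class lebesgue u" using assms by (auto simp: Lp_loc_def)
  have "f \<circ> u \<in> Lp_loc_fun q"
    unfolding Lp_loc_fun_def
    using u(1) by (auto simp: Lp_loc_fun_def intro!: compose_Lp_fun complete_finite_measure_lebesgue_on)
  then show ?thesis by (auto simp: u Lp_loc_def nemytskii_ae_class)
qed

text \<open>Composition with \<open>f\<close> acts pointwise and commutes with translation. This
  reduces both claims to the superposition operator on L^p(0,1).\<close>

lemma bochner_transform_nemytskii:
  "bochner_transform (nemytskii f U) t = superposition unit_interval f (bochner_transform U t)"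
  by (simp add: nemytskii_def bochner_transform_ae_class bochner_transform_def[of U] superposition_ae_class o_def)

lemma complete_finite_measure_unit_interval: "complete_finite_measure unit_interval"
  by (intro complete_finite_measure_lebesgue_on) simp

lemmas continuous_map_superposition_unit = continuous_map_superposition[OF complete_finite_measure_unit_interval]
lemmas superposition_uniform_unit = superposition_uniform[OF complete_finite_measure_unit_interval]

lemma nemytskii_Sp_aa:
  assumes "U \<in> Sp_aa p"
  shows "nemytskii f U \<in> Sp_aa q"
  using assms almost_automorphic_compose[OF _ continuous_map_superposition_unit]
  by (auto simp: Sp_aa_def nemytskii_Lp_loc bochner_transform_nemytskii[abs_def])

lemma Sp_aa_mtotally_bounded:
  fixes U :: "(real \<Rightarrow> 'x) set"
  assumes "U \<in> Sp_aa p"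
  shows "Metric_space.mtotally_bounded (Lp unit_interval p) (Lp_dist unit_interval p) (range (bochner_transform U))"
  using assms almost_automorphic_mtotally_bounded[of "Lp_metric unit_interval p" "bochner_transform U"]
  by (auto simp: Sp_aa_def unit_interval.Lp_metric_simps p)

lemma Sp_ap_mtotally_bounded:
  fixes U :: "(real \<Rightarrow> 'x) set"
  assumes "U \<in> Sp_ap p"
  shows "Metric_space.mtotally_bounded (Lp unit_interval p) (Lp_dist unit_interval p) (range (bochner_transform U))"
  using assms almost_periodic_mtotally_bounded[of "Lp_metric unit_interval p" "bochner_transform U"]
  by (auto simp: Sp_ap_def unit_interval.Lp_metric_simps p)

lemma nemytskii_Sp_ap:
  assumes U: "U \<in> Sp_ap p"
  shows "nemytskii f U \<in> Sp_ap q"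
proof -
  have loc: "U \<in> Lp_loc p" and ap: "almost_periodic (Lp_metric unit_interval p) (bochner_transform U)"
    using U by (auto simp: Sp_ap_def)
  have "almost_periodic (Lp_metric unit_interval q) (\<lambda>t. superposition unit_interval f (bochner_transform U t))"
  proof (rule almost_periodic_compose[OF ap continuous_map_superposition_unit])
    fix e :: real assume "e > 0"
    from superposition_uniform_unit[OF Sp_ap_mtotally_bounded[OF U] this]
    show "\<exists>d>0. \<forall>F\<in>range (bochner_transform U). \<forall>G\<in>range (bochner_transform U).
        mdist (Lp_metric unit_interval p) F G < d \<longrightarrow>
        mdist (Lp_metric unit_interval q) (superposition unit_interval f F) (superposition unit_interval f G) < e"
      using bochner_transform_Lp[OF loc]
      by (auto simp: unit_interval.Lp_metric_simps p q)
  qed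
  then show ?thesis
    using loc by (simp add: Sp_ap_def nemytskii_Lp_loc bochner_transform_nemytskii[abs_def])
qed

text \<open>Shared core of both continuity claims: total boundedness of the range for
  \<open>U\<close> gives one \<open>d\<close> for all \<open>t\<close>, and a Stepanov distance
  below \<open>d\<close> brings the Bochner transforms within \<open>d\<close> at every
  \<open>t\<close>. Nothing beyond a finite norm is asked of the locally integrable
  \<open>V\<close>.\<close>

lemma nemytskii_Sp_dist:
  assumes U: "U \<in> Lp_loc p" "Sp_enorm p (ae_rep U) < \<infinity>"
    and tb: "Metric_space.mtotally_bounded (Lp unit_interval p) (Lp_dist unit_interval p) (range (bochner_transform U))"
    and e: "e > 0"
  shows "\<exists>d>0. \<forall>V\<in>Lp_loc p. Sp_enorm p (ae_rep V) < \<infinity> \<longrightarrow> Sp_dist p U V < d \<longrightarrow>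
    Sp_dist q (nemytskii f U) (nemytskii f V) < e"
proof -
  \<comment> \<open>With \<open>e / 2\<close>, the supremum over \<open>t\<close> is at most
    \<open>e / 2\<close> and stays strictly below \<open>e\<close>.\<close>
  obtain d where d: "d > 0"
    "\<And>t G. G \<in> Lp unit_interval p \<Longrightarrow> Lp_dist unit_interval p (bochner_transform U t) G < d \<Longrightarrow>
      Lp_dist unit_interval q (superposition unit_interval f (bochner_transform U t)) (superposition unit_interval f G) < e / 2"
    using superposition_uniform_unit[OF tb, of "e / 2"] e by auto
  have "Sp_dist q (nemytskii f U) (nemytskii f V) < e"
    if V: "V \<in> Lp_loc p" "Sp_enorm p (ae_rep V) < \<infinity>" and UV: "Sp_dist p U V < d" for V
  proof -
    let ?D = "\<lambda>x. ae_rep U x - ae_rep V x"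
    have rep: "ae_rep W \<in> Lp_loc_fun p" if "W \<in> Lp_loc p" for W :: "(real \<Rightarrow> 'x) set"
      using that by (auto simp: Lp_loc_def intro: ae_rep_Lp_loc_fun)
    \<comment> \<open>As \<open>enn2real\<close> sends infinity to 0, only finiteness makes
      \<open>Sp_dist p U V < d\<close> a genuine bound.\<close>
    have fin: "Sp_enorm p ?D < \<infinity>"
      using U V rep p by (intro Sp_enorm_diff_finite) auto
    have "Lp_norm unit_interval q (\<lambda>\<theta>. ae_rep (nemytskii f U) (t + \<theta>) - ae_rep (nemytskii f V) (t + \<theta>)) \<le> e / 2" for t
    proof -
      have "ennreal (Lp_norm unit_interval p (\<lambda>\<theta>. ?D (t + \<theta>))) \<le> Sp_enorm p ?D"
        unfolding Sp_enorm_def by (rule SUP_upper) simp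
      then have "enn2real (ennreal (Lp_norm unit_interval p (\<lambda>\<theta>. ?D (t + \<theta>)))) \<le> Sp_norm p ?D"
        unfolding Sp_norm_def using fin by (intro enn2real_mono) auto
      also have "\<dots> < d" using UV by (simp add: Sp_dist_def)
      finally have "Lp_dist unit_interval p (bochner_transform U t) (bochner_transform V t) < d"
        using U(1) V(1) p by (simp add: Lp_dist_bochner_transform)
      from d(2)[OF bochner_transform_Lp[OF V(1)] this] show ?thesis
        using U(1) V(1) q
        by (simp add: Lp_dist_bochner_transform nemytskii_Lp_loc flip: bochner_transform_nemytskii)
    qed
    then have "Sp_enorm q (\<lambda>x. ae_rep (nemytskii f U) x - ae_rep (nemytskii f V) x) \<le> ennreal (e / 2)"
      unfolding Sp_enorm_def by (intro SUP_least ennreal_leI)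
    then have "Sp_dist q (nemytskii f U) (nemytskii f V) \<le> enn2real (ennreal (e / 2))"
      unfolding Sp_dist_def Sp_norm_def by (intro enn2real_mono) auto
    with e show ?thesis by simp
  qed
  with d(1) show ?thesis by blast
qed

lemma continuous_map_nemytskii_Sp_aa:
  "continuous_map (mtopology_of (Sp_aa_metric p)) (mtopology_of (Sp_aa_metric q)) (nemytskii f)"
proof -
  have "\<exists>d>0. \<forall>V\<in>Sp_aa p. Sp_dist p U V < d \<longrightarrow> Sp_dist q (nemytskii f U) (nemytskii f V) < e"
    if U: "U \<in> Sp_aa p" and "e > 0" for U and e :: real
    using nemytskii_Sp_dist[OF _ Sp_aa_bounded[OF U p] Sp_aa_mtotally_bounded[OF U] \<open>e > 0\<close>] U
      Sp_aa_bounded[OF _ p] unfolding Sp_aa_def by blast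
  then show ?thesis
    by (simp add: mtopology_of_continuous_map Sp_aa_metric_simps p q nemytskii_Sp_aa)
qed

lemma continuous_map_nemytskii_Sp_ap:
  "continuous_map (mtopology_of (Sp_ap_metric p)) (mtopology_of (Sp_ap_metric q)) (nemytskii f)"
proof -
  have "\<exists>d>0. \<forall>V\<in>Sp_ap p. Sp_dist p U V < d \<longrightarrow> Sp_dist q (nemytskii f U) (nemytskii f V) < e"
    if U: "U \<in> Sp_ap p" and "e > 0" for U and e :: real
    using nemytskii_Sp_dist[OF _ Sp_ap_bounded[OF U p] Sp_ap_mtotally_bounded[OF U] \<open>e > 0\<close>] U
      Sp_ap_bounded[OF _ p] unfolding Sp_ap_def by blast
  then show ?thesis
    by (simp add: mtopology_of_continuous_map Sp_ap_metric_simps p q nemytskii_Sp_ap)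
qed

end

theorem corollary6p10:
  fixes f :: "'x::banach \<Rightarrow> 'y::banach" and p q a b :: real
  assumes "1 \<le> p" and "1 \<le> q"
    and "continuous_on UNIV f"
    and "a > 0" and "b > 0"
    and "\<And>x. norm (f x) \<le> a * norm x powr (p / q) + b"
  shows "(nemytskii f \<in> Sp_aa p \<rightarrow> Sp_aa q \<and>
          continuous_map (mtopology_of (Sp_aa_metric p)) (mtopology_of (Sp_aa_metric q)) (nemytskii f)) \<and>
         (nemytskii f \<in> Sp_ap p \<rightarrow> Sp_ap q \<and>
          continuous_map (mtopology_of (Sp_ap_metric p)) (mtopology_of (Sp_ap_metric q)) (nemytskii f))"
proof -
  interpret growth_condition f p q a b
    by unfold_locales (use assms in auto)
  show ?thesis
    using nemytskii_Sp_aa nemytskii_Sp_ap continuous_map_nemytskii_Sp_aa continuous_map_nemytskii_Sp_ap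
    by blast
qed

end
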